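(* Let $f:\mathbb{N}\to\mathbb{R}_+$ and the distribution $H$ on $\mathbb{N}$ satisfy the Main Assumption stated in the context, with Malthusian rate $\lambda$ and $f_*=\inf_{i\ge1}f(i)>0$. Let $\mathcal{N}_\emptyset$ denote the in-degree of the root of $\mathcal{T}^c(\chi)$ (see context), let $\mathcal{D}$ be a random variable with distribution $H$, and let $G_k(\ell)=\sum_{j=1}^\ell\frac1{f(j)^k}$ for $k,\ell\in\mathbb{N}$. Then for any $x>0$, $$P(\mathcal{N}_\emptyset>x)\le E\Big[(2\mathcal{D}+1)\,e^{-\lambda G_1(\lceil x/\mathcal{D}\rceil)+2\lambda^2G_2(\lceil x/\mathcal{D}\rceil)}\Big],$$ $$P(\mathcal{N}_\emptyset>x)\ge\frac12E\Big[e^{-\lambda\left(G_1(\lceil x/\mathcal{D}\rceil)+\frac{4f(1)^2}{f_*}\log(2\mathcal{D})\,G_2(\lceil x/\mathcal{D}\rceil)\right)}\Big].$$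
   Context: Throughout $\mathbb{N}=\{1,2,\dots\}$. For $f:\mathbb{N}\to\mathbb{R}_+$, $\{\xi_f(t):t\ge0\}$ is the Markovian pure birth process with $\xi_f(0)=0$ and birth rates $P(\xi_f(t+dt)=k+1\mid\xi_f(t)=k)=f(k+1)\,dt+o(dt)$, $k\ge0$. Define $\hat\rho(\theta)=E[\int_0^\infty e^{-\theta s}\xi_f(ds)]=\sum_{n\ge1}\prod_{i=1}^n\frac{f(i)}{\theta+f(i)}$. Main Assumption. $H$ is a distribution on $\mathbb{N}$ with finite mean $\mu$. In addition: (i) there exists $\lambda>0$ with $\hat\rho(\lambda)=1$ (the Malthusian rate); (ii) $f(k)\le C_fk$ for all $k\ge1$, for some constant $C_f<\infty$; (iii) $f_*:=\inf_{i\ge1}f(i)>0$; (iv) with $\underline\theta:=\inf\{\theta>0:\hat\rho(\theta)<\infty\}$, $\lim_{\theta\searrow\underline\theta}\hat\rho(\theta)>1$. $\mathcal{T}^c(t)$ is the discrete skeleton at time $t$ (edges directed from offspring to parent) of the marked continuous-time branching process whose root is born at time $0$ and in which the $k$th node to be born has mark $\mathcal{D}_k$ and, from its birth on, reproduces according to $\bar\xi_f^{(k)}=\sum_{i=1}^{\mathcal{D}_k}\xi_f^{k,i}$, where $\{\mathcal{D}_k\}$ are i.i.d. with distribution $H$ and $\{\xi_f^{k,i}\}$ are i.i.d. copies of $\xi_f$, independent of $\{\mathcal D_k\}$. The time $\chi$ is exponential with rate $\lambda$, independent of the process. In particular the root's in-degree is $\mathcal{N}_\emptyset\overset{d}{=}\sum_{i=1}^{\mathcal{D}}\xi_f^{(i)}(\chi)$,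 with $\xi_f^{(i)}$ i.i.d. copies of $\xi_f$, and $\mathcal{D}$, $\chi$ and $\{\xi_f^{(i)}\}$ independent. *)

theory Defs
  imports
    "HOL-Probability.Probability"
    "HOL-Library.Landau_Symbols"
    "Graph_Theory.Digraph"
begin

text \<open>The positive integers are rendered as the part \<open>{1..}\<close> of \<^typ>\<open>nat\<close>; the value
  \<open>f 0\<close> of a rate function \<open>f\<close> is never used.\<close>

section \<open>Pure birth processes\<close>

text \<open>\<open>p h k j\<close> is the probability of a transition from \<open>k\<close> to \<open>j\<close> within a time span \<open>h\<close>.
  The finite set \<open>I\<close>, which may be empty, holds the past instants at which the history is known.\<close>

definition homogeneous_markov ::
    "'a measure \<Rightarrow> (real \<Rightarrow> nat \<Rightarrow> nat \<Rightarrow> real) \<Rightarrow> (real \<Rightarrow> 'a \<Rightarrow> nat) \<Rightarrow> bool" where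
  "homogeneous_markov M p X \<longleftrightarrow>
     (\<forall>I t h x k j. finite I \<longrightarrow> I \<subseteq> {0..t} \<longrightarrow> 0 \<le> t \<longrightarrow> 0 \<le> h \<longrightarrow>
        \<P>(\<omega> in M. (\<forall>s\<in>I. X s \<omega> = x s) \<and> X t \<omega> = k) > 0 \<longrightarrow>
        \<P>(\<omega> in M. X (t + h) \<omega> = j \<bar> (\<forall>s\<in>I. X s \<omega> = x s) \<and> X t \<omega> = k) = p h k j)"

text \<open>The two conditions on \<open>p\<close> together say that upward jumps of size at least two, as well
  as downward jumps, have rate zero.\<close>

definition pure_birth_process ::
    "'a measure \<Rightarrow> (nat \<Rightarrow> real) \<Rightarrow> (real \<Rightarrow> 'a \<Rightarrow> nat) \<Rightarrow> bool" where
  "pure_birth_process M f X \<longleftrightarrow>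
     prob_space M \<and>
     (\<forall>t\<ge>0. X t \<in> measurable M (count_space UNIV)) \<and>
     (AE \<omega> in M. X 0 \<omega> = 0 \<and> mono_on {0..} (\<lambda>t. X t \<omega>) \<and>
        (\<forall>t\<ge>0. continuous (at_right t) (\<lambda>s. X s \<omega>))) \<and>
     (\<exists>p. homogeneous_markov M p X \<and>
        (\<forall>k. (\<lambda>h. p h k (k + 1) - f (k + 1) * h) \<in> o[at_right 0](\<lambda>h. h) \<and>
             (\<lambda>h. p h k k - (1 - f (k + 1) * h)) \<in> o[at_right 0](\<lambda>h. h)))"

text \<open>Expectation of the integral of \<open>exp (- \<theta> s)\<close> against the Lebesgue-Stieltjes measure of
  the path. Extending the path by its value at time 0 to negative times puts no mass
  on \<open>{..0}\<close>. The value may be infinite.\<close>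

definition rho_hat :: "'a measure \<Rightarrow> (real \<Rightarrow> 'a \<Rightarrow> nat) \<Rightarrow> real \<Rightarrow> ennreal" where
  "rho_hat M X \<theta> =
     (\<integral>\<^sup>+\<omega>. (\<integral>\<^sup>+s\<in>{0..}. ennreal (exp (- \<theta> * s))
              \<partial>interval_measure (\<lambda>s. real (X (max 0 s) \<omega>))) \<partial>M)"


section \<open>The standing assumption\<close>

definition f_star :: "(nat \<Rightarrow> real) \<Rightarrow> real" where
  "f_star f = (INF i\<in>{1..}. f i)"

definition malthusian_rate :: "(real \<Rightarrow> ennreal) \<Rightarrow> real \<Rightarrow> bool" where
  "malthusian_rate \<rho> lam \<longleftrightarrow> lam > 0 \<and> \<rho> lam = 1"

definition theta_low :: "(real \<Rightarrow> ennreal) \<Rightarrow> real" where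
  "theta_low \<rho> = Inf {\<theta>. \<theta> > 0 \<and> \<rho> \<theta> < \<infinity>}"

text \<open>The limit \<open>L\<close> at \<open>theta_low \<rho>\<close> is taken in \<^typ>\<open>ennreal\<close> and may be infinite.\<close>

definition main_assumption ::
    "(nat \<Rightarrow> real) \<Rightarrow> nat pmf \<Rightarrow> (real \<Rightarrow> ennreal) \<Rightarrow> bool" where
  "main_assumption f H \<rho> \<longleftrightarrow>
     (\<forall>k\<ge>1. f k \<ge> 0) \<and>
     0 \<notin> set_pmf H \<and>
     integrable (measure_pmf H) real \<and>
     (\<exists>lam. malthusian_rate \<rho> lam) \<and>
     (\<exists>C. \<forall>k\<ge>1. f k \<le> C * real k) \<and>
     f_star f > 0 \<and>
     (\<exists>L. (\<rho> \<longlongrightarrow> L) (at_right (theta_low \<rho>)) \<and> L > 1)"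


section \<open>The marked branching process and its discrete skeleton\<close>

text \<open>Individuals are numbered \<open>1, 2, \<dots>\<close> in order of birth: \<open>birth k\<close> is the birth time
  and \<open>D k\<close> the mark of the \<open>k\<close>-th individual, and \<open>parent k\<close> is the number of its parent
  (meaningful for \<open>k \<ge> 2\<close> only). The copies \<open>\<xi> k i\<close> with \<open>i > D k\<close> exist but are not used.\<close>

definition offspring ::
    "(nat \<Rightarrow> 'a \<Rightarrow> nat) \<Rightarrow> (nat \<Rightarrow> nat \<Rightarrow> real \<Rightarrow> 'a \<Rightarrow> nat) \<Rightarrow> nat \<Rightarrow> real \<Rightarrow> 'a \<Rightarrow> nat" where
  "offspring D \<xi> k t \<omega> = (\<Sum>i=1..D k \<omega>. \<xi> k i t \<omega>)"

definition mark_family :: "(nat \<Rightarrow> 'a \<Rightarrow> nat) \<Rightarrow> 'a \<Rightarrow> nat \<Rightarrow> nat" where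
  "mark_family D \<omega> = (\<lambda>k\<in>{1..}. D k \<omega>)"

abbreviation mark_space :: "(nat \<Rightarrow> nat) measure" where
  "mark_space \<equiv> PiM {1..} (\<lambda>_. count_space UNIV)"

definition birth_family ::
    "(nat \<Rightarrow> nat \<Rightarrow> real \<Rightarrow> 'a \<Rightarrow> nat) \<Rightarrow> 'a \<Rightarrow> nat \<times> nat \<times> real \<Rightarrow> nat" where
  "birth_family \<xi> \<omega> = (\<lambda>(k, i, t)\<in>{1..} \<times> {1..} \<times> {0..}. \<xi> k i t \<omega>)"

abbreviation birth_space :: "(nat \<times> nat \<times> real \<Rightarrow> nat) measure" where
  "birth_space \<equiv> PiM ({1..} \<times> {1..} \<times> {0..}) (\<lambda>_. count_space UNIV)"

text \<open>The library's \<open>indep_var\<close> requires both random variables to have values in the same type;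
  the following is its heterogeneous version.\<close>

definition indep_rv ::
    "'a measure \<Rightarrow> 'b measure \<Rightarrow> ('a \<Rightarrow> 'b) \<Rightarrow> 'c measure \<Rightarrow> ('a \<Rightarrow> 'c) \<Rightarrow> bool" where
  "indep_rv M S X T Y \<longleftrightarrow>
     X \<in> measurable M S \<and> Y \<in> measurable M T \<and>
     prob_space.indep_set M {X -` A \<inter> space M | A. A \<in> sets S}
                            {Y -` B \<inter> space M | B. B \<in> sets T}"

text \<open>The last assumption says that from its birth on, individual \<open>k\<close> reproduces according to
  its offspring process: it has exactly \<open>offspring D \<xi> k t \<omega>\<close> children up to age \<open>t\<close>.\<close>

locale marked_branching_process = prob_space M
  for M :: "'a measure" and f :: "nat \<Rightarrow> real" and H :: "nat pmf"
    and D :: "nat \<Rightarrow> 'a \<Rightarrow> nat" and \<xi> :: "nat \<Rightarrow> nat \<Rightarrow> real \<Rightarrow> 'a \<Rightarrow> nat"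
    and birth :: "nat \<Rightarrow> 'a \<Rightarrow> real" and parent :: "nat \<Rightarrow> 'a \<Rightarrow> nat" +
  assumes marks_indep: "indep_vars (\<lambda>_. count_space UNIV) D {1..}"
    and marks_distr: "\<And>k. k \<ge> 1 \<Longrightarrow> distr M (count_space UNIV) (D k) = measure_pmf H"
    and births_indep:
      "indep_vars (\<lambda>_. PiM {0..} (\<lambda>_. count_space UNIV))
         (\<lambda>(k, i) \<omega>. \<lambda>t\<in>{0..}. \<xi> k i t \<omega>) ({1..} \<times> {1..})"
    and births_copy: "\<And>k i. k \<ge> 1 \<Longrightarrow> i \<ge> 1 \<Longrightarrow> pure_birth_process M f (\<xi> k i)"
    and marks_births_indep:
      "indep_rv M mark_space (mark_family D) birth_space (birth_family \<xi>)"
    and birth_measurable: "\<And>k. k \<ge> 1 \<Longrightarrow> birth k \<in> borel_measurable M"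
    and parent_measurable: "\<And>k. k \<ge> 2 \<Longrightarrow> parent k \<in> measurable M (count_space UNIV)"
    and root_birth: "AE \<omega> in M. birth 1 \<omega> = 0"
    and birth_order: "AE \<omega> in M. mono_on {1..} (\<lambda>k. birth k \<omega>)"
    and parent_older: "AE \<omega> in M. \<forall>k\<ge>2. parent k \<omega> \<in> {1..<k}"
    and reproduction:
      "AE \<omega> in M. \<forall>k\<ge>1. \<forall>t\<ge>0.
         finite {m. m \<ge> 2 \<and> parent m \<omega> = k \<and> birth m \<omega> \<le> birth k \<omega> + t} \<and>
         card {m. m \<ge> 2 \<and> parent m \<omega> = k \<and> birth m \<omega> \<le> birth k \<omega> + t} = offspring D \<xi> k t \<omega>"

definition skeleton ::
    "(nat \<Rightarrow> 'a \<Rightarrow> real) \<Rightarrow> (nat \<Rightarrow> 'a \<Rightarrow> nat) \<Rightarrow> real \<Rightarrow> 'a \<Rightarrow> (nat, nat \<times> nat) pre_digraph" where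
  "skeleton birth parent t \<omega> =
     \<lparr> verts = {k. k \<ge> 1 \<and> birth k \<omega> \<le> t},
       arcs = {(k, parent k \<omega>) | k. k \<ge> 2 \<and> birth k \<omega> \<le> t},
       tail = fst, head = snd \<rparr>"

definition root_in_degree ::
    "(nat \<Rightarrow> 'a \<Rightarrow> real) \<Rightarrow> (nat \<Rightarrow> 'a \<Rightarrow> nat) \<Rightarrow> ('a \<Rightarrow> real) \<Rightarrow> 'a \<Rightarrow> nat" where
  "root_in_degree birth parent chi \<omega> = in_degree (skeleton birth parent (chi \<omega>) \<omega>) 1"

definition G_sum :: "(nat \<Rightarrow> real) \<Rightarrow> nat \<Rightarrow> nat \<Rightarrow> real" where
  "G_sum f k l = (\<Sum>j=1..l. 1 / f j ^ k)"

end

theory Submission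
  imports Defs
begin

text \<open>
  Up to a null set, the in-degree of the root is the sum of \<open>D 1\<close> pure birth processes stopped at
  the exponential time \<open>chi\<close>. Given \<open>D 1 = d\<close>, both bounds compare this sum with the event that a
  single process has reached the level \<open>m\<close>, where \<open>m\<close> is close to \<open>x / d\<close>: if the sum exceeds \<open>x\<close>,
  then by the pigeonhole principle some process has reached \<open>\<lceil>x / d\<rceil>\<close>, and if all \<open>d\<close> processes
  have reached \<open>\<lceil>x / d\<rceil> + 1\<close>, then the sum exceeds \<open>x\<close>.

  Everything that is needed about a pure birth process is contained in the tails
  \<open>S m t = P (X t \<ge> m)\<close>, that is, in the distribution functions of the hitting times \<open>T m\<close> of the
  levels. They solve the forward equations \<open>S (m + 1)' = f (m + 1) (S m - S (m + 1))\<close>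
  (\<open>upper_tail_has_derivative\<close>), which say that \<open>T m\<close> is a sum of independent exponential
  variables with rates \<open>f 1, \<dots>, f m\<close>. Induction over \<open>m\<close> along these equations yields the two
  exponential moments of \<open>T m\<close>: \<open>P (X chi \<ge> m) = E (exp (- lam T m))\<close> is the product of the
  \<open>f j / (lam + f j)\<close> (\<open>expectation_upper_tail_exponential\<close>), and Chernoff's inequality bounds
  \<open>P (T m > t)\<close> by \<open>exp (- s t)\<close> times the product of the \<open>f j / (f j - s)\<close>
  (\<open>upper_tail_Chernoff\<close>). A second-order expansion of the logarithm of either product
  produces \<open>G_sum f 1\<close> and \<open>G_sum f 2\<close>.

  For the upper bound, a union bound over the \<open>d\<close> processes suffices
  (\<open>prob_large_root_le\<close>). For the lower bound with \<open>d \<ge> 2\<close>, a time \<open>t\<close> is chosen by which each process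
  has failed to reach \<open>m\<close> with probability at most \<open>1 / (2 d)\<close>; then all of them have reached it with
  probability at least \<open>1 / 2\<close>, and \<open>chi > t\<close> has probability \<open>exp (- lam t)\<close>
  (\<open>prob_large_root_ge\<close>). For \<open>d = 1\<close> the constant \<open>4 log 2\<close> is too small for this argument,
  but there is only one process and the exact product bounds the probability
  (\<open>prob_large_root_1_ge\<close>). Summing over \<open>d\<close> gives the theorem.
\<close>

section \<open>Derivatives from one-sided increments\<close>

text \<open>A bound on the right increments only controls the right derivative. Since the error \<open>e h\<close> does
  not depend on the base point, the left increments at \<open>t\<close> can be read as right increments
  from \<open>t - h\<close>, and continuity of \<open>v\<close> moves the slope back to \<open>t\<close>.\<close>

lemma has_derivative_if_uniform_right_increments:
  fixes u v :: "real \<Rightarrow> real"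
  assumes incr: "\<And>t h. 0 \<le> t \<Longrightarrow> 0 \<le> h \<Longrightarrow> \<bar>u (t + h) - u t - h * v t\<bar> \<le> e h"
    and small: "e \<in> o[at_right 0](\<lambda>h. h)"
    and cont: "continuous_on {0..} v" and "0 \<le> t"
  shows "(u has_real_derivative v t) (at t within {0..})"
proof -
  have "\<exists>d>0. \<forall>s\<in>{0..}. 0 < \<bar>s - t\<bar> \<and> \<bar>s - t\<bar> < d \<longrightarrow> \<bar>(u s - u t) / (s - t) - v t\<bar> < r"
    if "r > 0" for r
  proof -
    have "\<forall>\<^sub>F h in at_right 0. \<bar>e h\<bar> \<le> r / 3 * \<bar>h\<bar>"
      using landau_o.smallD[OF small, of "r / 3"] that by simp
    then obtain d1 where d1: "d1 > 0" "\<And>h. 0 < h \<Longrightarrow> h < d1 \<Longrightarrow> \<bar>e h\<bar> \<le> r / 3 * \<bar>h\<bar>"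
      unfolding eventually_at_right_field by auto
    have "\<exists>d>0. \<forall>s\<in>{0..}. dist s t < d \<longrightarrow> dist (v s) (v t) < r / 3"
      using cont[unfolded continuous_on_iff, rule_format, of t "r / 3"] \<open>0 \<le> t\<close> \<open>r > 0\<close> by simp
    then obtain d2 where d2: "d2 > 0"
      "\<And>s. 0 \<le> s \<Longrightarrow> \<bar>s - t\<bar> < d2 \<Longrightarrow> \<bar>v s - v t\<bar> < r / 3"
      unfolding dist_real_def by auto
    have "\<bar>(u s - u t) / (s - t) - v t\<bar> < r"
      if s: "0 \<le> s" "0 < \<bar>s - t\<bar>" "\<bar>s - t\<bar> < min d1 d2" for s
    proof -
      \<comment> \<open>The increment is expanded at the smaller of the two points, which is \<open>s\<close> on the left of
        \<open>t\<close>; there \<open>v s\<close> has to be replaced by \<open>v t\<close>.\<close>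
      define a where "a = min s t"
      define h where "h = \<bar>s - t\<bar>"
      have h: "0 < h" "h < d1" "h < d2" and a: "0 \<le> a"
        using s \<open>0 \<le> t\<close> by (auto simp: h_def a_def)
      have eq: "(u s - u t) / (s - t) = (u (a + h) - u a) / h"
        by (cases "s < t") (auto simp: a_def h_def field_simps)
      have "\<bar>u (a + h) - u a - h * v a\<bar> \<le> r / 3 * h"
        using incr[of a h] d1(2)[of h] h a by simp
      moreover have "(u (a + h) - u a) / h - v a = (u (a + h) - u a - h * v a) / h"
        using h by (simp add: field_simps)
      ultimately have "\<bar>(u (a + h) - u a) / h - v a\<bar> \<le> r / 3"
        using h by (simp add: field_simps)
      moreover have "\<bar>v a - v t\<bar> < r / 3"
      proof (rule d2(2)[OF a])
        have "\<bar>a - t\<bar> \<le> h" by (auto simp: a_def h_def)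
        then show "\<bar>a - t\<bar> < d2" using h by linarith
      qed
      ultimately show ?thesis
        unfolding eq using \<open>r > 0\<close> by linarith
    qed
    then show ?thesis
      using d1(1) d2(1) by (intro exI[of _ "min d1 d2"]) auto
  qed
  then show ?thesis
    unfolding has_field_derivative_iff Lim_within dist_real_def by simp
qed

text \<open>This supplies the continuity of \<open>v\<close> in the preceding lemma: for the forward equations \<open>v\<close> is
  a combination of functions whose increments obey the same kind of bound.\<close>

lemma continuous_on_if_uniform_right_increments:
  fixes u v :: "real \<Rightarrow> real"
  assumes incr: "\<And>t h. 0 \<le> t \<Longrightarrow> 0 \<le> h \<Longrightarrow> \<bar>u (t + h) - u t - h * v t\<bar> \<le> e h"
    and small: "e \<in> o[at_right 0](\<lambda>h. h)"
    and bound: "\<And>t. 0 \<le> t \<Longrightarrow> \<bar>v t\<bar> \<le> B"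
  shows "continuous_on {0..} u"
proof -
  have B: "0 \<le> B" using bound[of 0] by simp
  have "\<exists>d>0. \<forall>s\<in>{0..}. \<bar>s - t\<bar> < d \<longrightarrow> \<bar>u s - u t\<bar> < r" if "r > 0" "0 \<le> t" for r t
  proof -
    have "\<forall>\<^sub>F h in at_right 0. \<bar>e h\<bar> \<le> 1 * \<bar>h\<bar>"
      using landau_o.smallD[OF small, of 1] by simp
    then obtain d1 where d1: "d1 > 0" "\<And>h. 0 < h \<Longrightarrow> h < d1 \<Longrightarrow> \<bar>e h\<bar> \<le> \<bar>h\<bar>"
      unfolding eventually_at_right_field by auto
    have "\<bar>u s - u t\<bar> < r" if s: "0 \<le> s" "\<bar>s - t\<bar> < min d1 (r / (B + 1))" for s
    proof (cases "s = t")
      case False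
      define a where "a = min s t"
      define h where "h = \<bar>s - t\<bar>"
      have h: "0 < h" "h < d1" "h < r / (B + 1)" and a: "0 \<le> a"
        using s \<open>0 \<le> t\<close> False by (auto simp: h_def a_def)
      have eq: "\<bar>u s - u t\<bar> = \<bar>u (a + h) - u a\<bar>"
        by (cases "s < t") (auto simp: a_def h_def)
      have "\<bar>u (a + h) - u a - h * v a\<bar> \<le> h"
        using incr[of a h] d1(2)[of h] h a by simp
      moreover have "\<bar>h * v a\<bar> \<le> h * B"
        using bound[OF a] h by (simp add: abs_mult)
      moreover have "h * B + h < r"
        using h B by (simp add: field_simps)
      ultimately show ?thesis
        unfolding eq by linarith
    qed (use \<open>r > 0\<close> in simp)
    then show ?thesis
      using d1(1) B that by (intro exI[of _ "min d1 (r / (B + 1))"]) auto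
  qed
  then show ?thesis
    unfolding continuous_on_iff dist_real_def by auto
qed

section \<open>The forward equations of a pure birth process\<close>

definition upper_tail :: "'a measure \<Rightarrow> (real \<Rightarrow> 'a \<Rightarrow> nat) \<Rightarrow> nat \<Rightarrow> real \<Rightarrow> real" where
  "upper_tail M X m t = \<P>(\<omega> in M. m \<le> X t \<omega>)"


context prob_space
begin

text \<open>Writing the Markov property as a product instead of a conditional probability removes the
  condition that the state \<open>j\<close> is reached with positive probability: for other \<open>j\<close>
  both sides vanish, whatever value \<open>p h j k\<close> has.\<close>

lemma joint_prob_eq_transition:
  assumes X: "pure_birth_process M f X" and p: "homogeneous_markov M p X"
    and "0 \<le> t" "0 \<le> h"
  shows "prob {\<omega>\<in>space M. X t \<omega> = j \<and> X (t + h) \<omega> = k} = prob {\<omega>\<in>space M. X t \<omega> = j} * p h j k"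
proof -
  have [measurable]: "X s \<in> measurable M (count_space UNIV)" if "0 \<le> s" for s
    using X that by (simp add: pure_birth_process_def)
  note [measurable] = this[OF \<open>0 \<le> t\<close>] this[of "t + h"]
  show ?thesis
  proof (cases "prob {\<omega>\<in>space M. X t \<omega> = j} > 0")
    case True
    have "\<P>(\<omega> in M. X (t + h) \<omega> = k \<bar> X t \<omega> = j) = p h j k"
      using p[unfolded homogeneous_markov_def, rule_format, of "{}" t h undefined j k] True assms
      by simp
    then show ?thesis
      using True by (simp add: cond_prob_def field_simps conj_commute)
  next
    case False
    then have z: "prob {\<omega>\<in>space M. X t \<omega> = j} = 0"
      by (simp add: zero_less_measure_iff)
    have "prob {\<omega>\<in>space M. X t \<omega> = j \<and> X (t + h) \<omega> = k} \<le> prob {\<omega>\<in>space M. X t \<omega> = j}"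
      using \<open>0 \<le> t\<close> by (intro finite_measure_mono) auto
    then show ?thesis
      using z by (simp add: measure_le_0_iff)
  qed
qed

text \<open>The forward equation up to \<open>o(h)\<close>. By monotonicity, \<open>X\<close> crosses the level \<open>m + 1\<close> between \<open>t\<close> and \<open>t + h\<close>
  in one of two ways: it leaves the state \<open>m\<close>, which happens at rate \<open>f (m + 1)\<close>, or it
  jumps by at least two from some state \<open>j < m\<close>, with probability at most
  \<open>1 - p h j j - p h j (j + 1) = o(h)\<close>. The transition probabilities do not depend on \<open>t\<close>, so
  neither does the error.\<close>

lemma upper_tail_increment:
  assumes X: "pure_birth_process M f X"
  shows "\<exists>e. e \<in> o[at_right 0](\<lambda>h. h) \<and> (\<forall>t h. 0 \<le> t \<longrightarrow> 0 \<le> h \<longrightarrow>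
      \<bar>upper_tail M X (Suc m) (t + h) - upper_tail M X (Suc m) t
        - h * (f (Suc m) * (upper_tail M X m t - upper_tail M X (Suc m) t))\<bar> \<le> e h)"
proof -
  have meas: "X s \<in> measurable M (count_space UNIV)" if "0 \<le> s" for s
    using X that by (simp add: pure_birth_process_def)
  obtain p where p: "homogeneous_markov M p X"
    and up: "\<And>k. (\<lambda>h. p h k (k + 1) - f (k + 1) * h) \<in> o[at_right 0](\<lambda>h. h)"
    and stay: "\<And>k. (\<lambda>h. p h k k - (1 - f (k + 1) * h)) \<in> o[at_right 0](\<lambda>h. h)"
    using X unfolding pure_birth_process_def by blast
  define a where "a h = \<bar>1 - p h m m - f (m + 1) * h\<bar>" for h
  define b where "b j h = \<bar>1 - p h j j - p h j (j + 1)\<bar>" for j h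
  define e where "e h = a h + (\<Sum>j<m. b j h)" for h
  have small_a: "a \<in> o[at_right 0](\<lambda>h. h)"
  proof -
    have "(\<lambda>h. - (p h m m - (1 - f (m + 1) * h))) \<in> o[at_right 0](\<lambda>h. h)"
      using stay[of m] by (subst landau_o.small.uminus_in_iff)
    also have "(\<lambda>h. - (p h m m - (1 - f (m + 1) * h))) = (\<lambda>h. 1 - p h m m - f (m + 1) * h)"
      by auto
    finally show ?thesis
      unfolding a_def landau_o.small.abs_in_iff .
  qed
  have small_b: "b j \<in> o[at_right 0](\<lambda>h. h)" for j
  proof -
    have "(\<lambda>h. - ((p h j j - (1 - f (j + 1) * h)) + (p h j (j + 1) - f (j + 1) * h)))
        \<in> o[at_right 0](\<lambda>h. h)"
      using sum_in_smallo(1)[OF stay[of j] up[of j]] by (subst landau_o.small.uminus_in_iff)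
    also have "(\<lambda>h. - ((p h j j - (1 - f (j + 1) * h)) + (p h j (j + 1) - f (j + 1) * h)))
        = (\<lambda>h. 1 - p h j j - p h j (j + 1))"
      by auto
    finally show ?thesis
      unfolding b_def landau_o.small.abs_in_iff .
  qed
  have "e \<in> o[at_right 0](\<lambda>h. h)"
    unfolding e_def by (intro sum_in_smallo small_a big_sum_in_smallo small_b)
  moreover have "\<bar>upper_tail M X (Suc m) (t + h) - upper_tail M X (Suc m) t
        - h * (f (Suc m) * (upper_tail M X m t - upper_tail M X (Suc m) t))\<bar> \<le> e h"
    if "0 \<le> t" "0 \<le> h" for t h
  proof -
    note [measurable] = meas[OF \<open>0 \<le> t\<close>] meas[of "t + h"]
    have [simp]: "0 \<le> t + h" using that by simp
    define P where "P j = prob {\<omega>\<in>space M. X t \<omega> = j}" for j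
    define Q where "Q j = prob {\<omega>\<in>space M. X t \<omega> = j \<and> Suc m \<le> X (t + h) \<omega>}" for j
    have P01: "0 \<le> P j" "P j \<le> 1" for j by (simp_all add: P_def)
    have mono: "AE \<omega> in M. X t \<omega> \<le> X (t + h) \<omega>"
    proof -
      have "AE \<omega> in M. mono_on {0..} (\<lambda>t. X t \<omega>)"
        using X unfolding pure_birth_process_def by auto
      then show ?thesis
        by eventually_elim (use that in \<open>auto elim!: mono_onD\<close>)
    qed
    \<comment> \<open>\<open>P j\<close> is the law of \<open>X t\<close>, and \<open>Q j\<close> the probability of crossing from the state \<open>j\<close>.\<close>
    have tails: "upper_tail M X m t - upper_tail M X (Suc m) t = P m"
    proof -
      have "{\<omega>\<in>space M. m \<le> X t \<omega>} = {\<omega>\<in>space M. Suc m \<le> X t \<omega>} \<union> {\<omega>\<in>space M. X t \<omega> = m}"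
        by auto
      then show ?thesis
        unfolding upper_tail_def P_def by (simp, subst finite_measure_Union) auto
    qed
    have "upper_tail M X (Suc m) (t + h) = prob ({\<omega>\<in>space M. Suc m \<le> X t \<omega>} \<union>
        (\<Union>j\<in>{..m}. {\<omega>\<in>space M. X t \<omega> = j \<and> Suc m \<le> X (t + h) \<omega>}))"
      unfolding upper_tail_def
      by (rule finite_measure_eq_AE) (use mono in \<open>auto elim!: eventually_mono\<close>)
    also have "\<dots> = upper_tail M X (Suc m) t + (\<Sum>j\<le>m. Q j)"
      unfolding Q_def upper_tail_def
      by (subst finite_measure_Union, simp, measurable, force,
          subst finite_measure_finite_Union) (auto simp: disjoint_family_on_def)
    finally have incr: "upper_tail M X (Suc m) (t + h) - upper_tail M X (Suc m) t = Q m + (\<Sum>j<m. Q j)"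
      by (simp add: lessThan_Suc_atMost[symmetric])
    have Qm: "Q m = P m * (1 - p h m m)"
    proof -
      have "P m = prob ({\<omega>\<in>space M. X t \<omega> = m \<and> Suc m \<le> X (t + h) \<omega>} \<union>
                        {\<omega>\<in>space M. X t \<omega> = m \<and> X (t + h) \<omega> = m})"
        unfolding P_def
        by (rule finite_measure_eq_AE) (use mono in \<open>auto elim!: eventually_mono\<close>)
      also have "\<dots> = Q m + P m * p h m m"
        unfolding Q_def
        by (subst finite_measure_Union)
           (auto simp: joint_prob_eq_transition[OF X p that] P_def)
      finally show ?thesis by (simp add: algebra_simps)
    qed
    have Qj: "0 \<le> Q j" "Q j \<le> b j h" if "j < m" for j
    proof -
      have "Q j \<le> prob {\<omega>\<in>space M. X t \<omega> = j \<and> j + 2 \<le> X (t + h) \<omega>}"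
        unfolding Q_def using that by (intro finite_measure_mono) auto
      also have "\<dots> = P j * (1 - p h j j - p h j (j + 1))"
      proof -
        have "P j = prob ({\<omega>\<in>space M. X t \<omega> = j \<and> j + 2 \<le> X (t + h) \<omega>} \<union>
            ({\<omega>\<in>space M. X t \<omega> = j \<and> X (t + h) \<omega> = j} \<union>
             {\<omega>\<in>space M. X t \<omega> = j \<and> X (t + h) \<omega> = j + 1}))"
          unfolding P_def
          by (rule finite_measure_eq_AE) (use mono in \<open>auto elim!: eventually_mono\<close>)
        also have "\<dots> = prob {\<omega>\<in>space M. X t \<omega> = j \<and> j + 2 \<le> X (t + h) \<omega>}
            + (P j * p h j j + P j * p h j (j + 1))"
          by (subst finite_measure_Union, simp, measurable, force, subst finite_measure_Union)
             (auto simp: joint_prob_eq_transition[OF X p \<open>0 \<le> t\<close> \<open>0 \<le> h\<close>]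
                joint_prob_eq_transition[OF X p \<open>0 \<le> t\<close> \<open>0 \<le> h\<close>, of _ "Suc _"] P_def)
        finally show ?thesis by (simp add: algebra_simps)
      qed
      also have "\<dots> \<le> P j * b j h"
        unfolding b_def using P01 by (intro mult_left_mono) auto
      also have "\<dots> \<le> 1 * b j h"
        using P01 by (intro mult_right_mono) (auto simp: b_def)
      finally show "0 \<le> Q j" "Q j \<le> b j h" by (auto simp: Q_def)
    qed
    have "Q m - h * (f (Suc m) * P m) = P m * (1 - p h m m - f (m + 1) * h)"
      unfolding Qm by (simp add: algebra_simps)
    then have "\<bar>Q m - h * (f (Suc m) * P m)\<bar> = P m * a h"
      using P01(1)[of m] by (simp add: a_def abs_mult)
    also have "\<dots> \<le> 1 * a h"
      using P01 by (intro mult_right_mono) (auto simp: a_def)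
    finally have "\<bar>Q m - h * (f (Suc m) * P m)\<bar> \<le> a h" by simp
    moreover have "0 \<le> (\<Sum>j<m. Q j)" "(\<Sum>j<m. Q j) \<le> (\<Sum>j<m. b j h)"
      using Qj by (auto intro!: sum_nonneg sum_mono)
    ultimately show ?thesis
      unfolding incr tails e_def by linarith
  qed
  ultimately show ?thesis by (intro exI[of _ e]) auto
qed

lemma upper_tail_0 [simp]: "upper_tail M X 0 t = 1"
  by (simp add: upper_tail_def prob_space)

lemma upper_tail_bounds [simp]: "0 \<le> upper_tail M X m t" "upper_tail M X m t \<le> 1"
  by (simp_all add: upper_tail_def)

lemma upper_tail_at_0:
  assumes X: "pure_birth_process M f X"
  shows "upper_tail M X (Suc m) 0 = 0"
proof -
  have "AE \<omega> in M. X 0 \<omega> = 0"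
    using X unfolding pure_birth_process_def by auto
  then have "AE \<omega> in M. \<not> Suc m \<le> X 0 \<omega>"
    by eventually_elim simp
  then show ?thesis
    unfolding upper_tail_def by (rule prob_eq_0_AE)
qed

lemma continuous_on_upper_tail:
  assumes X: "pure_birth_process M f X"
  shows "continuous_on {0..} (upper_tail M X m)"
proof (cases m)
  case 0
  then show ?thesis by (simp add: upper_tail_def)
next
  case (Suc k)
  obtain e where e: "e \<in> o[at_right 0](\<lambda>h. h)"
    and incr: "\<forall>t h. 0 \<le> t \<longrightarrow> 0 \<le> h \<longrightarrow>
      \<bar>upper_tail M X (Suc k) (t + h) - upper_tail M X (Suc k) t
        - h * (f (Suc k) * (upper_tail M X k t - upper_tail M X (Suc k) t))\<bar> \<le> e h"
    using upper_tail_increment[OF X, of k] by (elim exE conjE)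
  show ?thesis
    unfolding Suc
  proof (rule continuous_on_if_uniform_right_increments[OF incr[rule_format] e])
    fix t :: real
    have "\<bar>upper_tail M X k t - upper_tail M X (Suc k) t\<bar> \<le> 1"
      using upper_tail_bounds[of X k t] upper_tail_bounds[of X "Suc k" t] by linarith
    then show "\<bar>f (Suc k) * (upper_tail M X k t - upper_tail M X (Suc k) t)\<bar> \<le> \<bar>f (Suc k)\<bar>"
      by (simp add: abs_mult mult_left_le)
  qed auto
qed

lemma upper_tail_has_derivative:
  assumes X: "pure_birth_process M f X" and "0 \<le> t"
  shows "(upper_tail M X (Suc m) has_real_derivative
      f (Suc m) * (upper_tail M X m t - upper_tail M X (Suc m) t)) (at t within {0..})"
proof -
  obtain e where e: "e \<in> o[at_right 0](\<lambda>h. h)"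
    and incr: "\<forall>t h. 0 \<le> t \<longrightarrow> 0 \<le> h \<longrightarrow>
      \<bar>upper_tail M X (Suc m) (t + h) - upper_tail M X (Suc m) t
        - h * (f (Suc m) * (upper_tail M X m t - upper_tail M X (Suc m) t))\<bar> \<le> e h"
    using upper_tail_increment[OF X, of m] by (elim exE conjE)
  show ?thesis
  proof (rule has_derivative_if_uniform_right_increments[OF incr[rule_format] e])
    show "continuous_on {0..}
        (\<lambda>t. f (Suc m) * (upper_tail M X m t - upper_tail M X (Suc m) t))"
      by (intro continuous_on_mult continuous_on_const continuous_on_diff
          continuous_on_upper_tail[OF X])
  qed (use \<open>0 \<le> t\<close> in auto)
qed

lemma upper_tail_DERIV:
  assumes "pure_birth_process M f X" and "0 < t"
  shows "(upper_tail M X (Suc m) has_real_derivative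
      f (Suc m) * (upper_tail M X m t - upper_tail M X (Suc m) t)) (at t)"
proof -
  have "at t within {0..} = at t"
    by (rule at_within_interior) (simp add: assms(2))
  then show ?thesis
    using upper_tail_has_derivative[OF assms(1), of t m] assms(2) by simp
qed

end

section \<open>Exponential moments of the hitting times\<close>

context prob_space
begin

text \<open>The right-hand side is \<open>exp (- s t)\<close> times the moment generating function at \<open>s\<close> of the hitting
  time of \<open>m\<close>. It is obtained without that random variable: multiplied by \<open>exp (f (m + 1) t)\<close>,
  the difference of the two sides has a derivative that is nonnegative by the induction
  hypothesis, and at \<open>t = 0\<close> it is nonnegative since every factor is at least 1.\<close>

lemma upper_tail_Chernoff:
  assumes X: "pure_birth_process M f X"
    and s: "0 \<le> s" "\<And>k. 1 \<le> k \<Longrightarrow> s < f k" and "0 \<le> t"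
  shows "1 - upper_tail M X m t \<le> exp (- s * t) * (\<Prod>j=1..m. f j / (f j - s))"
  using \<open>0 \<le> t\<close>
proof (induction m arbitrary: t)
  case (Suc m)
  define S where "S = upper_tail M X"
  define F where "F = f (Suc m)"
  define A where "A = (\<Prod>j=1..m. f j / (f j - s))"
  define B where "B = A * F / (F - s)"
  define \<phi> where "\<phi> u = B * exp ((F - s) * u) - exp (F * u) * (1 - S (Suc m) u)" for u
  have F: "0 < F" "s < F" using s(2)[of "Suc m"] s(1) by (auto simp: F_def)
  have "1 \<le> f j / (f j - s)" if "1 \<le> j" for j
    using s(1) s(2)[OF that] by (simp add: field_simps)
  then have A1: "1 \<le> A" unfolding A_def by (intro prod_ge_1) auto
  have "A * (F - s) \<le> A * F" using A1 s(1) by (intro mult_left_mono) auto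
  then have "A \<le> B" using F by (simp add: B_def field_simps)
  with A1 have \<phi>0: "0 \<le> \<phi> 0"
    using upper_tail_at_0[OF X] by (simp add: \<phi>_def S_def)
  have "\<phi> 0 \<le> \<phi> t"
  proof (rule DERIV_nonneg_imp_increasing_open[OF Suc.prems])
    have "continuous_on {0..t} (S (Suc m))"
      unfolding S_def by (rule continuous_on_subset[OF continuous_on_upper_tail[OF X]]) auto
    then show "continuous_on {0..t} \<phi>"
      unfolding \<phi>_def by (intro continuous_intros)
  next
    fix u assume u: "0 < u" "u < t"
    have "(\<phi> has_real_derivative B * ((F - s) * exp ((F - s) * u))
        - (F * exp (F * u) * (1 - S (Suc m) u) - exp (F * u) * (F * (S m u - S (Suc m) u)))) (at u)"
      unfolding \<phi>_def
      using upper_tail_DERIV[OF X u(1), of m, folded S_def F_def]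
      by (intro DERIV_diff[OF _ DERIV_cong[OF DERIV_mult[of "\<lambda>u. exp (F * u)" "F * exp (F * u)"]]])
         (auto intro!: derivative_eq_intros simp: algebra_simps)
    moreover have "B * ((F - s) * exp ((F - s) * u))
        - (F * exp (F * u) * (1 - S (Suc m) u) - exp (F * u) * (F * (S m u - S (Suc m) u)))
        = F * exp (F * u) * (exp (- s * u) * A - (1 - S m u))"
    proof -
      have "B * (F - s) = A * F" using F by (simp add: B_def)
      moreover have "exp ((F - s) * u) = exp (F * u) * exp (- s * u)"
        by (simp add: algebra_simps flip: exp_add)
      ultimately have "B * ((F - s) * exp ((F - s) * u)) = A * F * (exp (F * u) * exp (- s * u))"
        by (metis mult.assoc)
      then show ?thesis by (simp add: algebra_simps)
    qed
    moreover have "0 \<le> F * exp (F * u) * (exp (- s * u) * A - (1 - S m u))"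
      using Suc.IH[of u] u F by (simp add: A_def S_def)
    ultimately show "\<exists>y. (\<phi> has_real_derivative y) (at u) \<and> 0 \<le> y" by metis
  qed
  with \<phi>0 have "exp (F * t) * (1 - S (Suc m) t) \<le> B * exp ((F - s) * t)"
    by (simp add: \<phi>_def)
  also have "\<dots> = exp (F * t) * (exp (- s * t) * B)"
    by (simp add: algebra_simps flip: exp_add)
  finally have "1 - S (Suc m) t \<le> exp (- s * t) * B"
    by (subst (asm) mult_le_cancel_left_pos) auto
  then show ?case
    by (simp add: S_def B_def A_def F_def)
qed simp

lemma continuous_on_upper_tail_max:
  assumes "pure_birth_process M f X"
  shows "continuous_on UNIV (\<lambda>t. upper_tail M X m (max 0 t))"
  by (rule continuous_on_compose2[OF continuous_on_upper_tail[OF assms]])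
     (auto intro!: continuous_intros)

lemma integrable_upper_tail:
  assumes X: "pure_birth_process M f X" and "prob_space E" "sets E = sets borel"
  shows "integrable E (\<lambda>t. upper_tail M X m (max 0 t))"
proof -
  interpret E: prob_space E by fact
  have "(\<lambda>t. upper_tail M X m (max 0 t)) \<in> borel_measurable borel"
    by (rule borel_measurable_continuous_onI[OF continuous_on_upper_tail_max[OF X]])
  then have "(\<lambda>t. upper_tail M X m (max 0 t)) \<in> borel_measurable E"
    using measurable_cong_sets[OF assms(3) refl] by blast
  then show ?thesis
    by (rule E.integrable_const_bound[of _ 1, rotated]) simp
qed

text \<open>The Laplace transform of the hitting time of \<open>m\<close>. Integrating the derivative of
  \<open>exp (- lam t) * upper_tail M X (m + 1) t\<close> over the half-line gives 0, and by the forward equation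
  this reads \<open>f (m + 1) * (I m - I (m + 1)) = lam * I (m + 1)\<close> for the expectations \<open>I\<close>
  on the left-hand side. The argument \<open>max 0 t\<close> makes the integrand continuous
  on the whole line.\<close>

lemma expectation_upper_tail_exponential:
  assumes X: "pure_birth_process M f X" and f: "\<And>k. 1 \<le> k \<Longrightarrow> 0 < f k" and lam: "0 < lam"
  shows "(\<integral>t. upper_tail M X m (max 0 t) \<partial>density lborel (exponential_density lam))
    = (\<Prod>j=1..m. f j / (lam + f j))"
proof (induction m)
  case 0
  interpret E: prob_space "density lborel (exponential_density lam)"
    using lam by (rule prob_space_exponential_density)
  show ?case using E.prob_space by simp
next
  case (Suc m)
  define E where "E = density lborel (exponential_density lam)"
  interpret E: prob_space E
    unfolding E_def using lam by (rule prob_space_exponential_density)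
  define F where "F = f (Suc m)"
  have F: "0 < F" using f[of "Suc m"] by (simp add: F_def)
  define S where "S = upper_tail M X m"
  define T where "T = upper_tail M X (Suc m)"
  define g where "g t = (F * (S (max 0 t) - T (max 0 t)) - lam * T (max 0 t)) / lam" for t
  have cont: "continuous_on {0..} S" "continuous_on {0..} T"
    unfolding S_def T_def by (rule continuous_on_upper_tail[OF X])+
  have int: "integrable E (\<lambda>t. S (max 0 t))" "integrable E (\<lambda>t. T (max 0 t))"
    unfolding S_def T_def
    by (rule integrable_upper_tail[OF X E.prob_space_axioms], simp add: E_def)+
  have intg: "integrable E g"
    unfolding g_def using int by auto
  then have [measurable]: "g \<in> borel_measurable borel"
    by (auto simp: E_def)
  define w where "w t = exponential_density lam t * g t" for t
  have intw: "integrable lborel w"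
    using intg unfolding E_def w_def
    by (subst (asm) integrable_density) (auto simp: exponential_density_nonneg lam)
  \<comment> \<open>\<open>v\<close> is the derivative to be integrated; for positive times it agrees with \<open>w\<close>, whose integral is
    a combination of expectations under the exponential law.\<close>
  define v where "v t = - lam * exp (- lam * t) * T t + exp (- lam * t) * (F * (S t - T t))" for t
  have vw: "v t = w t" if "0 < t" for t
  proof -
    have "w t = exp (- lam * t) * (F * (S t - T t) - lam * T t)"
      using that lam by (simp add: w_def g_def exponential_density_def mult.commute)
    then show ?thesis by (simp add: v_def algebra_simps)
  qed
  have "(LBINT t=0..\<infinity>. v t) = 0 - 0"
  proof (rule interval_integral_FTC_integrable)
    fix t :: real assume t: "(0::ereal) < ereal t" "ereal t < \<infinity>"
    then have t0: "0 < t" by simp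
    show "((\<lambda>t. exp (- lam * t) * T t) has_vector_derivative v t) (at t)"
    proof -
      have "(T has_real_derivative F * (S t - T t)) (at t)"
        unfolding T_def S_def F_def by (rule upper_tail_DERIV[OF X t0])
      then have "((\<lambda>t. exp (- lam * t) * T t) has_real_derivative v t) (at t)"
        unfolding v_def
        by (intro DERIV_cong[OF DERIV_mult[of "\<lambda>t. exp (- lam * t)" "- lam * exp (- lam * t)"]])
           (auto intro!: derivative_eq_intros simp: algebra_simps)
      then show ?thesis
        unfolding has_real_derivative_iff_has_vector_derivative .
    qed
    have "continuous (at t) S" "continuous (at t) T"
      using cont t0 by (auto intro: continuous_on_interior)
    then show "isCont v t"
      unfolding v_def
      by (intro continuous_add continuous_mult continuous_diff continuous_const
          isCont_exp' continuous_ident)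
  next
    have "set_integrable lborel {0<..} w"
      using intw unfolding set_integrable_def by (intro integrable_mult_indicator) auto
    then show "set_integrable lborel (einterval 0 \<infinity>) v"
      unfolding zero_ereal_def einterval_eq
      by (subst set_integrable_cong[OF refl refl, of _ v w]) (auto simp: vw)
  next
    have "((\<lambda>t. exp (- lam * t) * T t) \<longlongrightarrow> exp (- lam * 0) * T 0) (at 0 within {0..})"
      using cont(2) by (intro tendsto_intros) (auto simp: continuous_on)
    then have "((\<lambda>t. exp (- lam * t) * T t) \<longlongrightarrow> exp (- lam * 0) * T 0) (at_right 0)"
      by (rule tendsto_within_subset) auto
    then show "(((\<lambda>t. exp (- lam * t) * T t) \<circ> real_of_ereal) \<longlongrightarrow> 0) (at_right 0)"
      unfolding zero_ereal_def ereal_tendsto_simps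
      by (simp add: T_def upper_tail_at_0[OF X])
  next
    have "((\<lambda>t. exp (- lam * t)) \<longlongrightarrow> 0) at_top"
      using lam
      by (intro filterlim_compose[OF exp_at_bot] filterlim_tendsto_neg_mult_at_bot[OF tendsto_const])
         (auto simp: filterlim_ident)
    then have "((\<lambda>t. exp (- lam * t) * T t) \<longlongrightarrow> 0) at_top"
      by (rule tendsto_0_le[where K=1]) (auto simp: T_def intro!: always_eventually mult_left_le)
    then show "(((\<lambda>t. exp (- lam * t) * T t) \<circ> real_of_ereal) \<longlongrightarrow> 0) (at_left \<infinity>)"
      unfolding ereal_tendsto_simps .
  qed auto
  then have "0 = (\<integral>t. indicator {0<..} t * v t \<partial>lborel)"
    by (simp add: interval_lebesgue_integral_def set_lebesgue_integral_def zero_ereal_def einterval_eq)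
  also have "\<dots> = (\<integral>t. w t \<partial>lborel)"
  proof (rule integral_cong_AE)
    show "(\<lambda>t. indicator {0<..} t * v t) \<in> borel_measurable lborel"
    proof -
      have "(\<lambda>t. indicator {0<..} t * v t) = (\<lambda>t. indicator {0<..} t * w t)"
        by (auto simp: vw indicator_def)
      then show ?thesis using intw by auto
    qed
    show "AE t in lborel. indicator {0<..} t * v t = w t"
      using AE_lborel_singleton[of 0]
      by eventually_elim (auto simp: vw indicator_def, auto simp: w_def exponential_density_def)
  qed (use intw in auto)
  also have "\<dots> = (\<integral>t. g t \<partial>E)"
    unfolding E_def w_def by (subst integral_density) (auto simp: exponential_density_nonneg lam)
  also have "\<dots> = (F * ((\<integral>t. S (max 0 t) \<partial>E) - (\<integral>t. T (max 0 t) \<partial>E)) - lam * (\<integral>t. T (max 0 t) \<partial>E)) / lam"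
    unfolding g_def using int by simp
  finally have "(\<integral>t. T (max 0 t) \<partial>E) = F / (lam + F) * (\<integral>t. S (max 0 t) \<partial>E)"
    using lam F by (simp add: field_simps)
  then show ?case
    using Suc.IH unfolding E_def S_def T_def F_def by (simp add: mult.commute)
qed

end

section \<open>Estimates for the products over the rates\<close>

lemma inverse_one_plus_le_exp:
  fixes y :: real
  assumes "0 \<le> y"
  shows "1 / (1 + y) \<le> exp (- y + y\<^sup>2)"
proof -
  have "1 \<le> (1 + y) * (1 + (- y + y\<^sup>2))"
    using assms by (simp add: algebra_simps power2_eq_square)
  then have "1 / (1 + y) \<le> 1 + (- y + y\<^sup>2)"
    using assms by (simp add: pos_divide_le_eq mult.commute)
  also have "\<dots> \<le> exp (- y + y\<^sup>2)"
    by (rule exp_ge_add_one_self)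
  finally show ?thesis .
qed

text \<open>The coefficient 1 of \<open>y\<^sup>2\<close> matters: with 2 in its place, the estimate of the
  threshold time below would fail for \<open>d = 2\<close>. The Taylor polynomial of degree 2 of the
  exponential function suffices for this range of \<open>y\<close>.\<close>

lemma inverse_one_minus_le_exp:
  fixes y :: real
  assumes "0 \<le> y" "y \<le> 1 / 2"
  shows "1 / (1 - y) \<le> exp (y + y\<^sup>2)"
proof -
  define z where "z = y + y\<^sup>2"
  have "0 \<le> z" using assms by (simp add: z_def)
  have "(1 - y) * (1 + z + z\<^sup>2 / 2) - 1 = y\<^sup>2 / 2 * ((1 - y) * (1 + y)\<^sup>2 - 2 * y)"
    by (simp add: z_def power2_eq_square field_simps)
  moreover have "0 \<le> (1 - y) * (1 + y)\<^sup>2 - 2 * y"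
  proof -
    have "0 \<le> (1 - 2 * y) * (1 + y)" using assms by simp
    moreover have "y * (y * y) \<le> y * y"
      using assms by (intro mult_right_le_one_le mult_left_le_one_le) auto
    ultimately show ?thesis
      by (simp add: power2_eq_square algebra_simps)
  qed
  ultimately have "0 \<le> (1 - y) * (1 + z + z\<^sup>2 / 2) - 1"
    by (simp only: mult_nonneg_nonneg zero_le_power2 zero_le_divide_iff) simp
  then have "1 \<le> (1 - y) * (1 + z + z\<^sup>2 / 2)" by simp
  also have "\<dots> \<le> (1 - y) * exp z"
    using assms \<open>0 \<le> z\<close> by (intro mult_left_mono exp_lower_Taylor_quadratic) auto
  finally show ?thesis
    using assms by (simp add: z_def pos_divide_le_eq mult.commute)
qed

lemma exp_G_sum:
  "exp (a * G_sum f 1 n + b * G_sum f 2 n) = (\<Prod>j=1..n. exp (a / f j + b / (f j)\<^sup>2))"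
proof -
  have "a * G_sum f 1 n + b * G_sum f 2 n = (\<Sum>j=1..n. a / f j + b / (f j)\<^sup>2)"
    by (simp add: G_sum_def sum_distrib_left sum.distrib)
  then show ?thesis by (simp only: exp_sum finite_atLeastAtMost)
qed

lemma rate_prod_le_exp:
  assumes "\<And>k. 1 \<le> k \<Longrightarrow> 0 < f k" and "0 < lam"
  shows "(\<Prod>j=1..n. f j / (lam + f j)) \<le> exp (- lam * G_sum f 1 n + lam\<^sup>2 * G_sum f 2 n)"
  unfolding exp_G_sum
proof (rule prod_mono)
  fix j assume "j \<in> {1..n}"
  then have f: "0 < f j" using assms(1) by simp
  then have "f j / (lam + f j) = 1 / (1 + lam / f j)" by (simp add: field_simps)
  with inverse_one_plus_le_exp[of "lam / f j"] f assms(2)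
  show "0 \<le> f j / (lam + f j) \<and> f j / (lam + f j) \<le> exp (- lam / f j + lam\<^sup>2 / (f j)\<^sup>2)"
    by (simp add: power_divide)
qed

lemma exp_le_rate_prod:
  assumes "\<And>k. 1 \<le> k \<Longrightarrow> 0 < f k" and "0 < lam"
  shows "exp (- lam * G_sum f 1 n) \<le> (\<Prod>j=1..n. f j / (lam + f j))"
proof -
  have "exp (- lam * G_sum f 1 n + 0 * G_sum f 2 n) \<le> (\<Prod>j=1..n. f j / (lam + f j))"
    unfolding exp_G_sum
  proof (rule prod_mono)
    fix j assume "j \<in> {1..n}"
    then have f: "0 < f j" using assms(1) by simp
    have "1 + lam / f j \<le> exp (lam / f j)" by (rule exp_ge_add_one_self)
    then have "exp (- (lam / f j)) \<le> 1 / (1 + lam / f j)"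
      using f assms(2) by (simp add: exp_minus field_simps add_pos_pos)
    also have "1 / (1 + lam / f j) = f j / (lam + f j)" using f by (simp add: field_simps)
    finally show "0 \<le> exp (- lam / f j + 0 / (f j)\<^sup>2) \<and>
        exp (- lam / f j + 0 / (f j)\<^sup>2) \<le> f j / (lam + f j)" by simp
  qed
  then show ?thesis by simp
qed

lemma Chernoff_prod_le_exp:
  assumes "\<And>k. 1 \<le> k \<Longrightarrow> 2 * s \<le> f k" and "0 < s"
  shows "(\<Prod>j=1..n. f j / (f j - s)) \<le> exp (s * G_sum f 1 n + s\<^sup>2 * G_sum f 2 n)"
  unfolding exp_G_sum
proof (rule prod_mono)
  fix j assume "j \<in> {1..n}"
  then have f: "2 * s \<le> f j" using assms(1) by simp
  with \<open>0 < s\<close> have pos: "0 < f j" "0 < f j - s" by simp_all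
  then have "f j / (f j - s) = 1 / (1 - s / f j)" by (simp add: field_simps)
  also have "\<dots> \<le> exp (s / f j + (s / f j)\<^sup>2)"
    by (rule inverse_one_minus_le_exp) (use f pos \<open>0 < s\<close> in \<open>simp_all add: pos_divide_le_eq\<close>)
  finally show "0 \<le> f j / (f j - s) \<and> f j / (f j - s) \<le> exp (s / f j + s\<^sup>2 / (f j)\<^sup>2)"
    using pos by (simp add: power_divide)
qed

lemma G_sum_Suc: "G_sum f k (Suc n) = G_sum f k n + 1 / f (Suc n) ^ k"
  by (simp add: G_sum_def)

lemma G_sum_nonneg:
  assumes "\<And>k. 1 \<le> k \<Longrightarrow> 0 < f k"
  shows "0 \<le> G_sum f k n"
  unfolding G_sum_def using assms by (intro sum_nonneg) (auto intro!: divide_nonneg_nonneg zero_le_power less_imp_le)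

lemma G_sum_mono:
  assumes "\<And>k. 1 \<le> k \<Longrightarrow> 0 < f k" "m \<le> n"
  shows "G_sum f k m \<le> G_sum f k n"
  unfolding G_sum_def using assms
  by (intro sum_mono2) (auto intro!: divide_nonneg_nonneg zero_le_power less_imp_le)

text \<open>The first summand of \<open>G_sum f 2 n\<close> is \<open>1 / (f 1)\<^sup>2\<close>. This is why the factor \<open>(f 1)\<^sup>2\<close> appears
  in the theorem: it makes the second-order term large enough to absorb every error of
  order \<open>1 / c\<close>, in particular a shift of the level by one.\<close>

lemma inverse_lower_bound_le_G_sum_2:
  assumes c: "0 < c" "\<And>k. 1 \<le> k \<Longrightarrow> c \<le> f k" and "1 \<le> n"
  shows "1 / c \<le> (f 1)\<^sup>2 / c * G_sum f 2 n"
proof -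
  have pos: "0 < f k" if "1 \<le> k" for k using c(1) c(2)[OF that] by linarith
  have "G_sum f 2 1 \<le> G_sum f 2 n" by (rule G_sum_mono[OF pos \<open>1 \<le> n\<close>])
  then have "(f 1)\<^sup>2 * (1 / (f 1)\<^sup>2) \<le> (f 1)\<^sup>2 * G_sum f 2 n"
    by (intro mult_left_mono) (simp_all add: G_sum_def)
  then have "1 \<le> (f 1)\<^sup>2 * G_sum f 2 n" using pos[of 1] by simp
  then show ?thesis using c(1) by (simp add: divide_right_mono)
qed

text \<open>With \<open>s = c / 2\<close>, the left-hand side is the time after which Chernoff's bound for the level \<open>n + 1\<close>
  has dropped to \<open>exp (- L)\<close>. Let \<open>a = (f 1)\<^sup>2 / c * G_sum f 2 n\<close>. The additional summand of \<open>G_sum f 1\<close> costs at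
  most \<open>a\<close>, the two parts of the second-order term at most \<open>a / 2\<close> each, and the last term at most \<open>2 L a\<close>;
  this is at most \<open>4 L a\<close> exactly when \<open>1 \<le> L\<close>.\<close>

lemma threshold_time_le:
  assumes c: "0 < c" "\<And>k. 1 \<le> k \<Longrightarrow> c \<le> f k" and "1 \<le> n" "1 \<le> L"
  shows "G_sum f 1 (Suc n) + c / 2 * G_sum f 2 (Suc n) + L / (c / 2)
    \<le> G_sum f 1 n + 4 * (f 1)\<^sup>2 / c * L * G_sum f 2 n"
proof -
  define a where "a = (f 1)\<^sup>2 / c * G_sum f 2 n"
  have a: "1 / c \<le> a"
    unfolding a_def by (rule inverse_lower_bound_le_G_sum_2[OF c \<open>1 \<le> n\<close>])
  have a0: "0 < a" using a c(1) by (meson divide_pos_pos less_le_trans zero_less_one)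
  have fc: "c \<le> f (Suc n)" using c(2) by simp
  have pos: "0 < f k" if "1 \<le> k" for k using c(1) c(2)[OF that] by linarith
  have 1: "1 / f (Suc n) \<le> a"
    using frac_le[of 1 1 c "f (Suc n)"] fc c(1) a by simp
  have "1 / (f (Suc n))\<^sup>2 \<le> 1 / c\<^sup>2"
    using fc c(1) by (intro frac_le power_mono) auto
  then have "c / 2 * (1 / (f (Suc n))\<^sup>2) \<le> c / 2 * (1 / c\<^sup>2)"
    using c(1) by (intro mult_left_mono) auto
  also have "\<dots> = 1 / c / 2" using c(1) by (simp add: power2_eq_square)
  also have "\<dots> \<le> a / 2" using a by simp
  finally have 2: "c / 2 * (1 / (f (Suc n))\<^sup>2) \<le> a / 2" .
  have "c\<^sup>2 \<le> (f 1)\<^sup>2" using c by (intro power_mono) auto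
  then have "c \<le> (f 1)\<^sup>2 / c" using c(1) by (simp add: pos_le_divide_eq power2_eq_square)
  then have "c * G_sum f 2 n \<le> a"
    unfolding a_def by (rule mult_right_mono[OF _ G_sum_nonneg[OF pos]])
  then have 3: "c / 2 * G_sum f 2 n \<le> a / 2" by simp
  have "L * (1 / c) \<le> L * a" using a \<open>1 \<le> L\<close> by (intro mult_left_mono) auto
  then have "2 * (L * (1 / c)) \<le> 2 * (L * a)" by (rule mult_left_mono) simp
  then have 4: "L / (c / 2) \<le> 2 * (L * a)" by (simp add: mult.commute)
  have 5: "a \<le> L * a" using a0 \<open>1 \<le> L\<close> by simp
  have "4 * (f 1)\<^sup>2 / c * L * G_sum f 2 n = 4 * (L * a)" by (simp add: a_def)
  moreover have "A + p + (q + r) + w \<le> A + 4 * y"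
    if "p \<le> a" "q \<le> a / 2" "r \<le> a / 2" "w \<le> 2 * y" "a \<le> y" for A p q r w y :: real
    using that by linarith
  ultimately show ?thesis
    using 1 2 3 4 5 by (simp only: G_sum_Suc distrib_left power_one_right)
qed

section \<open>Sampling the offspring processes at an independent random time\<close>

lemma (in prob_space) distr_pair_indep_rv:
  assumes "indep_rv M S X T Y"
  shows "distr M S X \<Otimes>\<^sub>M distr M T Y = distr M (S \<Otimes>\<^sub>M T) (\<lambda>\<omega>. (X \<omega>, Y \<omega>))"
proof (rule pair_measure_eqI)
  have [measurable]: "X \<in> measurable M S" "Y \<in> measurable M T"
    and indep: "indep_set {X -` A \<inter> space M | A. A \<in> sets S} {Y -` B \<inter> space M | B. B \<in> sets T}"
    using assms by (auto simp: indep_rv_def)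
  interpret X: prob_space "distr M S X" by (rule prob_space_distr) simp
  interpret Y: prob_space "distr M T Y" by (rule prob_space_distr) simp
  show "sigma_finite_measure (distr M S X)" "sigma_finite_measure (distr M T Y)"
    by unfold_locales
  fix A B assume A: "A \<in> sets (distr M S X)" and B: "B \<in> sets (distr M T Y)"
  have "prob ((X -` A \<inter> space M) \<inter> (Y -` B \<inter> space M))
      = prob (X -` A \<inter> space M) * prob (Y -` B \<inter> space M)"
    by (rule indep_setD[OF indep]) (use A B in auto)
  moreover have "(\<lambda>\<omega>. (X \<omega>, Y \<omega>)) -` (A \<times> B) \<inter> space M
      = (X -` A \<inter> space M) \<inter> (Y -` B \<inter> space M)"
    by auto
  ultimately show "emeasure (distr M S X) A * emeasure (distr M T Y) B
      = emeasure (distr M (S \<Otimes>\<^sub>M T) (\<lambda>\<omega>. (X \<omega>, Y \<omega>))) (A \<times> B)"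
    using A B by (simp add: emeasure_distr emeasure_eq_measure ennreal_mult)
qed simp

text \<open>The time \<open>t\<close> is rounded to a point of the grid of width \<open>1 / (N + 1)\<close>, down for \<open>b = 0\<close> and up for \<open>b = 1\<close>. A
  path evaluated at a random time is not a measurable function of the time and the path for the
  product \<open>\<sigma>\<close>-algebra of \<open>birth_space\<close>, but it is one if the time has countably many values. As the
  paths are monotone, rounding up and down encloses the value at the true time.\<close>

definition grid_clock :: "nat \<Rightarrow> nat \<Rightarrow> real \<Rightarrow> real" where
  "grid_clock b N t = real (nat \<lfloor>real (Suc N) * t\<rfloor> + b) / real (Suc N)"

lemma grid_clock_nonneg [simp]: "0 \<le> grid_clock b N t"
  by (simp add: grid_clock_def)

lemma le_grid_clock_1: "t \<le> grid_clock 1 N t"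
proof -
  have "real (Suc N) * t \<le> real (nat \<lfloor>real (Suc N) * t\<rfloor> + 1)" by linarith
  then show ?thesis by (simp add: grid_clock_def field_simps)
qed

lemma grid_clock_0_le:
  assumes "0 \<le> t"
  shows "grid_clock 0 N t \<le> t"
proof -
  have "0 \<le> real (Suc N) * t" using assms by simp
  then have "real (nat \<lfloor>real (Suc N) * t\<rfloor> + 0) \<le> real (Suc N) * t" by linarith
  then show ?thesis by (simp add: grid_clock_def field_simps)
qed

lemma grid_clock_tendsto: "(\<lambda>N. grid_clock b N t) \<longlonglongrightarrow> max 0 t"
proof (rule real_tendsto_sandwich)
  have eq: "max 0 (real (Suc N) * t) / real (Suc N) = max 0 t" for N
    by (simp add: max_def zero_le_mult_iff mult_le_0_iff)
  show "\<forall>\<^sub>F N in sequentially. max 0 t - 1 / real (Suc N) \<le> grid_clock b N t"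
  proof (rule always_eventually, rule allI)
    fix N
    have "max 0 (real (Suc N) * t) - 1 \<le> real (nat \<lfloor>real (Suc N) * t\<rfloor> + b)" by linarith
    then have "(max 0 (real (Suc N) * t) - 1) / real (Suc N) \<le> grid_clock b N t"
      unfolding grid_clock_def by (rule divide_right_mono) simp
    then show "max 0 t - 1 / real (Suc N) \<le> grid_clock b N t"
      by (simp only: diff_divide_distrib eq)
  qed
  show "\<forall>\<^sub>F N in sequentially. grid_clock b N t \<le> max 0 t + real b * (1 / real (Suc N))"
  proof (rule always_eventually, rule allI)
    fix N
    have "real (nat \<lfloor>real (Suc N) * t\<rfloor> + b) \<le> max 0 (real (Suc N) * t) + real b" by linarith
    then have "grid_clock b N t \<le> (max 0 (real (Suc N) * t) + real b) / real (Suc N)"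
      unfolding grid_clock_def by (rule divide_right_mono) simp
    then show "grid_clock b N t \<le> max 0 t + real b * (1 / real (Suc N))"
      by (simp only: add_divide_distrib eq times_divide_eq_right mult_1_right)
  qed
  have inv: "(\<lambda>N. 1 / real (Suc N)) \<longlonglongrightarrow> 0"
    by (rule LIMSEQ_Suc[OF lim_1_over_n])
  show "(\<lambda>N. max 0 t - 1 / real (Suc N)) \<longlonglongrightarrow> max 0 t"
    using tendsto_diff[OF tendsto_const[of "max 0 t"] inv] by simp
  show "(\<lambda>N. max 0 t + real b * (1 / real (Suc N))) \<longlonglongrightarrow> max 0 t"
    using tendsto_add[OF tendsto_const[of "max 0 t"] tendsto_mult[OF tendsto_const[of "real b"] inv]] by simp
qed

locale stopped_branching_process = marked_branching_process M f H D \<xi> birth parent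
  for M :: "'a measure" and f H D \<xi> birth parent +
  fixes chi :: "'a \<Rightarrow> real" and lam :: real
  assumes chi_distr: "distributed M lborel chi (exponential_density lam)"
    and chi_indep: "indep_rv M borel chi (mark_space \<Otimes>\<^sub>M birth_space)
          (\<lambda>\<omega>. (mark_family D \<omega>, birth_family \<xi> \<omega>))"
    and lam_pos: "0 < lam"
    and f_pos: "\<And>k. 1 \<le> k \<Longrightarrow> 0 < f k"
begin

lemma chi_measurable [measurable]: "chi \<in> borel_measurable M"
  using chi_indep by (simp add: indep_rv_def)

lemma chi_pos: "AE \<omega> in M. 0 < chi \<omega>"
proof -
  have "prob {\<omega>\<in>space M. 0 < chi \<omega>} = 1"
    using exponential_distributedD_gt[OF chi_distr _ lam_pos, of 0] by simp
  then show ?thesis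
    by (subst (asm) prob_Collect_eq_1) auto
qed

lemma D_measurable [measurable]: "1 \<le> k \<Longrightarrow> D k \<in> measurable M (count_space UNIV)"
  using marks_indep by (auto simp: indep_vars_def)

lemma \<xi>_measurable:
  assumes "1 \<le> i" "0 \<le> t"
  shows "\<xi> 1 i t \<in> measurable M (count_space UNIV)"
  using births_copy[of 1 i] assms by (simp add: pure_birth_process_def)

lemma prob_D_eq: "prob {\<omega>\<in>space M. D 1 \<omega> = d} = pmf H d"
proof -
  have "pmf H d = measure (distr M (count_space UNIV) (D 1)) {d}"
    by (simp add: marks_distr pmf.rep_eq)
  also have "\<dots> = prob (D 1 -` {d} \<inter> space M)"
    by (rule measure_distr) auto
  also have "D 1 -` {d} \<inter> space M = {\<omega>\<in>space M. D 1 \<omega> = d}" by auto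
  finally show ?thesis by simp
qed

lemma mark_coordinate:
  "(\<lambda>m. m 1) \<in> measurable mark_space (count_space UNIV)"
  by (rule measurable_component_singleton) simp

lemma birth_coordinate:
  assumes "1 \<le> i" "0 \<le> t"
  shows "(\<lambda>b. b (1, i, t)) \<in> measurable birth_space (count_space UNIV)"
  by (rule measurable_component_singleton) (use assms in simp)

lemma prob_mark_birth:
  assumes "1 \<le> i" "0 \<le> t"
  shows "prob {\<omega>\<in>space M. D 1 \<omega> = d \<and> \<xi> 1 i t \<omega> \<in> B}
      = pmf H d * prob {\<omega>\<in>space M. \<xi> 1 i t \<omega> \<in> B}"
proof -
  define E where "E = (\<lambda>m. m 1) -` {d} \<inter> space mark_space"
  define F where "F = (\<lambda>b. b (1, i, t)) -` B \<inter> space birth_space"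
  have E: "E \<in> sets mark_space"
    unfolding E_def by (rule measurable_sets[OF mark_coordinate]) simp
  have F: "F \<in> sets birth_space"
    unfolding F_def by (rule measurable_sets[OF birth_coordinate[OF assms]]) simp
  have meas: "mark_family D \<in> measurable M mark_space" "birth_family \<xi> \<in> measurable M birth_space"
    and indep: "indep_set {mark_family D -` A \<inter> space M | A. A \<in> sets mark_space}
                          {birth_family \<xi> -` B \<inter> space M | B. B \<in> sets birth_space}"
    using marks_births_indep unfolding indep_rv_def by blast+
  have EM: "mark_family D -` E \<inter> space M = {\<omega>\<in>space M. D 1 \<omega> = d}"
    unfolding E_def using measurable_space[OF meas(1)] by (auto simp: mark_family_def)
  have FM: "birth_family \<xi> -` F \<inter> space M = {\<omega>\<in>space M. \<xi> 1 i t \<omega> \<in> B}"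
    unfolding F_def using measurable_space[OF meas(2)] assms by (auto simp: birth_family_def)
  have "prob ((mark_family D -` E \<inter> space M) \<inter> (birth_family \<xi> -` F \<inter> space M))
      = prob (mark_family D -` E \<inter> space M) * prob (birth_family \<xi> -` F \<inter> space M)"
    by (rule indep_setD[OF indep]) (use E F in auto)
  moreover have "{\<omega>\<in>space M. D 1 \<omega> = d} \<inter> {\<omega>\<in>space M. \<xi> 1 i t \<omega> \<in> B}
      = {\<omega>\<in>space M. D 1 \<omega> = d \<and> \<xi> 1 i t \<omega> \<in> B}" by auto
  ultimately show ?thesis
    unfolding EM FM prob_D_eq by simp
qed

text \<open>Fubini's theorem for the joint law of \<open>chi\<close> and the pair of the mark and birth families.\<close>

lemma prob_mark_birth_at_grid_clock:
  assumes "1 \<le> i"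
  shows "prob {\<omega>\<in>space M. D 1 \<omega> = d \<and> m \<le> \<xi> 1 i (grid_clock b N (chi \<omega>)) \<omega>}
      = pmf H d * (\<integral>t. upper_tail M (\<xi> 1 i) m (grid_clock b N t) \<partial>distr M borel chi)"
proof -
  note [simp del] = One_nat_def
  let ?Y = "\<lambda>\<omega>. (mark_family D \<omega>, birth_family \<xi> \<omega>)"
  let ?S = "mark_space \<Otimes>\<^sub>M birth_space"
  have Y[measurable]: "?Y \<in> measurable M ?S"
    using chi_indep unfolding indep_rv_def by blast
  interpret E: prob_space "distr M borel chi" by (rule prob_space_distr[OF chi_measurable])
  interpret Y: prob_space "distr M ?S ?Y" by (rule prob_space_distr[OF Y])
  define g where "g = (\<lambda>t. nat \<lfloor>real (Suc N) * t\<rfloor>)"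
  define \<tau> where "\<tau> k = real (k + b) / real (Suc N)" for k
  have clock: "grid_clock b N t = \<tau> (g t)" for t
    by (simp add: grid_clock_def \<tau>_def g_def)
  have \<tau>: "0 \<le> \<tau> k" for k by (simp add: \<tau>_def)
  have g[measurable]: "g \<in> measurable borel (count_space UNIV)"
    unfolding g_def by measurable
  have [measurable]: "(\<lambda>z. fst (snd z) 1) \<in> measurable (borel \<Otimes>\<^sub>M ?S) (count_space UNIV)"
    by (rule measurable_compose[OF _ mark_coordinate]) measurable
  have [measurable]: "(\<lambda>z. snd (snd z) (1, i, \<tau> (g (fst z)))) \<in> measurable (borel \<Otimes>\<^sub>M ?S) (count_space UNIV)"
  proof (rule measurable_compose_countable[where f = "\<lambda>k z. snd (snd z) (1, i, \<tau> k)"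
        and g = "\<lambda>z. g (fst z)"])
    show "(\<lambda>z. snd (snd z) (1, i, \<tau> k)) \<in> measurable (borel \<Otimes>\<^sub>M ?S) (count_space UNIV)" for k
      by (rule measurable_compose[OF _ birth_coordinate[OF assms \<tau>]]) measurable
  qed measurable
  define A where "A = {z\<in>space (borel \<Otimes>\<^sub>M ?S). fst (snd z) 1 = d \<and> m \<le> snd (snd z) (1, i, \<tau> (g (fst z)))}"
  have A: "A \<in> sets (borel \<Otimes>\<^sub>M ?S)"
    unfolding A_def by measurable
  have tail_meas: "(\<lambda>t. upper_tail M (\<xi> 1 i) m (\<tau> (g t))) \<in> borel_measurable (distr M borel chi)"
    by measurable
  have slice: "emeasure (distr M ?S ?Y) (Pair t -` A)
      = ennreal (pmf H d * upper_tail M (\<xi> 1 i) m (\<tau> (g t)))" for t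
  proof -
    have "Pair t -` A \<in> sets ?S" by (rule sets_Pair1[OF A])
    then have "emeasure (distr M ?S ?Y) (Pair t -` A) = prob (?Y -` (Pair t -` A) \<inter> space M)"
      by (simp add: emeasure_distr emeasure_eq_measure)
    also have "?Y -` (Pair t -` A) \<inter> space M
        = {\<omega>\<in>space M. D 1 \<omega> = d \<and> \<xi> 1 i (\<tau> (g t)) \<omega> \<in> {m..}}"
      using measurable_space[OF Y] assms \<tau>
      by (auto simp: A_def space_pair_measure mark_family_def birth_family_def)
    finally show ?thesis
      by (simp only: prob_mark_birth[OF assms \<tau>]) (simp add: upper_tail_def)
  qed
  have "ennreal (prob {\<omega>\<in>space M. D 1 \<omega> = d \<and> m \<le> \<xi> 1 i (\<tau> (g (chi \<omega>))) \<omega>})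
      = emeasure (distr M (borel \<Otimes>\<^sub>M ?S) (\<lambda>\<omega>. (chi \<omega>, ?Y \<omega>))) A"
  proof -
    have "(\<lambda>\<omega>. (chi \<omega>, ?Y \<omega>)) -` A \<inter> space M
        = {\<omega>\<in>space M. D 1 \<omega> = d \<and> m \<le> \<xi> 1 i (\<tau> (g (chi \<omega>))) \<omega>}"
      using measurable_space[OF Y] assms \<tau>
      by (auto simp: A_def space_pair_measure mark_family_def birth_family_def)
    then show ?thesis
      using A by (simp add: emeasure_distr emeasure_eq_measure)
  qed
  also have "\<dots> = (\<integral>\<^sup>+t. emeasure (distr M ?S ?Y) (Pair t -` A) \<partial>distr M borel chi)"
    unfolding distr_pair_indep_rv[OF chi_indep, symmetric]
    by (rule Y.emeasure_pair_measure_alt) (use A in simp)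
  also have "\<dots> = ennreal (\<integral>t. pmf H d * upper_tail M (\<xi> 1 i) m (\<tau> (g t)) \<partial>distr M borel chi)"
    unfolding slice
    by (intro nn_integral_eq_integral E.integrable_const_bound[of _ 1])
       (use tail_meas in \<open>auto intro!: mult_le_one pmf_le_1\<close>)
  finally show ?thesis
    unfolding clock by (simp add: ennreal_inj)
qed

text \<open>On an ever finer grid the sampled probability converges to the one for \<open>chi\<close> itself, because the tail
  is a continuous function of time.\<close>

lemma prob_mark_birth_at_grid_clock_tendsto:
  assumes "1 \<le> i"
  shows "(\<lambda>N. prob {\<omega>\<in>space M. D 1 \<omega> = d \<and> m \<le> \<xi> 1 i (grid_clock b N (chi \<omega>)) \<omega>})
      \<longlonglongrightarrow> pmf H d * (\<Prod>j=1..m. f j / (lam + f j))"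
proof -
  have X: "pure_birth_process M f (\<xi> 1 i)" using births_copy assms by simp
  interpret E: prob_space "distr M borel chi" by (rule prob_space_distr[OF chi_measurable])
  have law: "distr M borel chi = density lborel (exponential_density lam)"
    unfolding distributed_distr_eq_density[OF chi_distr, symmetric] by (rule distr_cong) simp_all
  have cont: "continuous_on UNIV (\<lambda>t. upper_tail M (\<xi> 1 i) m (max 0 t))"
    by (rule continuous_on_upper_tail_max[OF X])
  have "(\<lambda>N. \<integral>t. upper_tail M (\<xi> 1 i) m (grid_clock b N t) \<partial>distr M borel chi)
      \<longlonglongrightarrow> (\<integral>t. upper_tail M (\<xi> 1 i) m (max 0 t) \<partial>distr M borel chi)"
  proof (rule integral_dominated_convergence[where w = "\<lambda>_. 1"])
    show "(\<lambda>t. upper_tail M (\<xi> 1 i) m (max 0 t)) \<in> borel_measurable (distr M borel chi)"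
      using borel_measurable_continuous_onI[OF cont] by simp
    show "(\<lambda>t. upper_tail M (\<xi> 1 i) m (grid_clock b N t)) \<in> borel_measurable (distr M borel chi)" for N
    proof -
      have "(\<lambda>t. (\<lambda>k. upper_tail M (\<xi> 1 i) m (real (k + b) / real (Suc N))) (nat \<lfloor>real (Suc N) * t\<rfloor>))
          \<in> borel_measurable borel" by measurable
      then show ?thesis by (simp add: grid_clock_def)
    qed
    show "AE t in distr M borel chi. (\<lambda>N. upper_tail M (\<xi> 1 i) m (grid_clock b N t))
        \<longlonglongrightarrow> upper_tail M (\<xi> 1 i) m (max 0 t)"
    proof (rule AE_I2)
      fix t
      have "isCont (\<lambda>t. upper_tail M (\<xi> 1 i) m (max 0 t)) (max 0 t)"
        by (rule continuous_on_interior[OF cont]) simp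
      from isCont_tendsto_compose[OF this grid_clock_tendsto[of b t]]
      show "(\<lambda>N. upper_tail M (\<xi> 1 i) m (grid_clock b N t)) \<longlonglongrightarrow> upper_tail M (\<xi> 1 i) m (max 0 t)"
        by (simp add: max_absorb2)
    qed
  qed auto
  also have "(\<integral>t. upper_tail M (\<xi> 1 i) m (max 0 t) \<partial>distr M borel chi) = (\<Prod>j=1..m. f j / (lam + f j))"
    unfolding law by (rule expectation_upper_tail_exponential[OF X f_pos lam_pos])
  finally show ?thesis
    unfolding prob_mark_birth_at_grid_clock[OF assms] by (rule tendsto_mult[OF tendsto_const])
qed

lemma prob_chi_gt:
  assumes "0 \<le> t"
  shows "prob {\<omega>\<in>space M. t < chi \<omega>} = exp (- lam * t)"
  using exponential_distributedD_gt[OF chi_distr assms lam_pos] by (simp add: mult.commute)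

lemma prob_chi_mark_birth:
  assumes "1 \<le> i" "0 \<le> t"
  shows "prob {\<omega>\<in>space M. t < chi \<omega> \<and> D 1 \<omega> = d \<and> \<xi> 1 i t \<omega> \<in> B}
      = exp (- lam * t) * pmf H d * prob {\<omega>\<in>space M. \<xi> 1 i t \<omega> \<in> B}"
proof -
  let ?Y = "\<lambda>\<omega>. (mark_family D \<omega>, birth_family \<xi> \<omega>)"
  let ?S = "mark_space \<Otimes>\<^sub>M birth_space"
  have Y: "?Y \<in> measurable M ?S"
    and indep: "indep_set {chi -` A \<inter> space M | A. A \<in> sets borel} {?Y -` B \<inter> space M | B. B \<in> sets ?S}"
    using chi_indep unfolding indep_rv_def by blast+
  define E where "E = ((\<lambda>m. m 1) -` {d} \<inter> space mark_space) \<times> ((\<lambda>b. b (1, i, t)) -` B \<inter> space birth_space)"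
  have E: "E \<in> sets ?S"
    unfolding E_def
    by (rule pair_measureI[OF measurable_sets[OF mark_coordinate] measurable_sets[OF birth_coordinate[OF assms]]])
       simp_all
  have "prob ((chi -` {t<..} \<inter> space M) \<inter> (?Y -` E \<inter> space M))
      = prob (chi -` {t<..} \<inter> space M) * prob (?Y -` E \<inter> space M)"
  proof (rule indep_setD[OF indep])
    show "chi -` {t<..} \<inter> space M \<in> {chi -` A \<inter> space M | A. A \<in> sets borel}"
      by (intro CollectI exI[of _ "{t<..}"]) simp
    show "?Y -` E \<inter> space M \<in> {?Y -` B \<inter> space M | B. B \<in> sets ?S}"
      by (intro CollectI exI[of _ E]) (simp only: E simp_thms)
  qed
  moreover have EM: "?Y -` E \<inter> space M = {\<omega>\<in>space M. D 1 \<omega> = d \<and> \<xi> 1 i t \<omega> \<in> B}"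
    unfolding E_def using measurable_space[OF Y] assms
    by (auto simp: mark_family_def birth_family_def space_pair_measure)
  moreover have "chi -` {t<..} \<inter> space M = {\<omega>\<in>space M. t < chi \<omega>}" by auto
  moreover have "{\<omega>\<in>space M. t < chi \<omega>} \<inter> {\<omega>\<in>space M. D 1 \<omega> = d \<and> \<xi> 1 i t \<omega> \<in> B}
      = {\<omega>\<in>space M. t < chi \<omega> \<and> D 1 \<omega> = d \<and> \<xi> 1 i t \<omega> \<in> B}" by auto
  ultimately show ?thesis
    by (simp only: prob_mark_birth[OF assms] prob_chi_gt[OF assms(2)] mult.assoc)
qed

lemma grid_clock_event:
  assumes "1 \<le> i"
  shows "{\<omega>\<in>space M. D 1 \<omega> = d \<and> m \<le> \<xi> 1 i (grid_clock b N (chi \<omega>)) \<omega>} \<in> sets M"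
proof -
  have [measurable]: "(\<lambda>\<omega>. \<xi> 1 i (grid_clock b N (chi \<omega>)) \<omega>) \<in> measurable M (count_space UNIV)"
    unfolding grid_clock_def
    by (rule measurable_compose_countable[where f = "\<lambda>k \<omega>. \<xi> 1 i (real (k + b) / real (Suc N)) \<omega>"
          and g = "\<lambda>\<omega>. nat \<lfloor>real (Suc N) * chi \<omega>\<rfloor>"])
       (rule \<xi>_measurable[OF assms], simp, measurable)
  have [measurable]: "D 1 \<in> measurable M (count_space UNIV)" by (rule D_measurable) simp
  show ?thesis by measurable
qed

end

section \<open>The in-degree of the root\<close>

context stopped_branching_process
begin

lemma births_mono: "AE \<omega> in M. \<forall>i\<ge>1. mono_on {0..} (\<lambda>t. \<xi> 1 i t \<omega>)"
proof (rule AE_all_countable[THEN iffD2], rule allI)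
  fix i
  show "AE \<omega> in M. 1 \<le> i \<longrightarrow> mono_on {0..} (\<lambda>t. \<xi> 1 i t \<omega>)"
  proof (cases "1 \<le> i")
    case True
    then have "pure_birth_process M f (\<xi> 1 i)" by (intro births_copy) auto
    then have "AE \<omega> in M. mono_on {0..} (\<lambda>t. \<xi> 1 i t \<omega>)"
      unfolding pure_birth_process_def by auto
    then show ?thesis by eventually_elim simp
  qed simp
qed

lemma root_in_degree_eq_card:
  "root_in_degree birth parent chi \<omega> = card {k. 2 \<le> k \<and> birth k \<omega> \<le> chi \<omega> \<and> parent k \<omega> = 1}"
proof -
  have "in_arcs (skeleton birth parent (chi \<omega>) \<omega>) 1
      = (\<lambda>k. (k, parent k \<omega>)) ` {k. 2 \<le> k \<and> birth k \<omega> \<le> chi \<omega> \<and> parent k \<omega> = 1}"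
    by (auto simp: in_arcs_def skeleton_def)
  then show ?thesis
    by (simp add: root_in_degree_def in_degree_def card_image inj_on_def)
qed

text \<open>The probability of a set that is not measurable is 0 by convention, so the lower bound depends on this.
  Measurability has to come from the birth times and parents, as the offspring count that equals
  the in-degree almost surely need not be measurable at a random time.\<close>

lemma root_in_degree_measurable [measurable]:
  "root_in_degree birth parent chi \<in> measurable M (count_space UNIV)"
proof -
  have "(\<lambda>\<omega>. card {k. 2 \<le> k \<and> birth k \<omega> \<le> chi \<omega> \<and> parent k \<omega> = 1}) \<in> measurable M (count_space UNIV)"
  proof (rule measurable_card)
    fix k
    show "{\<omega>\<in>space M. k \<in> {k. 2 \<le> k \<and> birth k \<omega> \<le> chi \<omega> \<and> parent k \<omega> = 1}} \<in> sets M"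
    proof (cases "2 \<le> k")
      case True
      then have [measurable]: "birth k \<in> borel_measurable M" "parent k \<in> measurable M (count_space UNIV)"
        by (auto intro: birth_measurable parent_measurable)
      show ?thesis using True by simp
    qed simp
  qed
  moreover have "root_in_degree birth parent chi
      = (\<lambda>\<omega>. card {k. 2 \<le> k \<and> birth k \<omega> \<le> chi \<omega> \<and> parent k \<omega> = 1})"
    by (rule ext) (rule root_in_degree_eq_card)
  ultimately show ?thesis by (simp only:)
qed

lemma root_in_degree_eq_offspring:
  "AE \<omega> in M. root_in_degree birth parent chi \<omega> = offspring D \<xi> 1 (chi \<omega>) \<omega>"
  using root_birth reproduction chi_pos
proof eventually_elim
  case (elim \<omega>)
  have "root_in_degree birth parent chi \<omega>
      = card {m. m \<ge> 2 \<and> parent m \<omega> = 1 \<and> birth m \<omega> \<le> birth 1 \<omega> + chi \<omega>}"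
    unfolding root_in_degree_eq_card elim(1) by (rule arg_cong[where f = card]) auto
  moreover have "\<dots> = offspring D \<xi> 1 (chi \<omega>) \<omega>"
    by (rule elim(2)[THEN spec, THEN mp, OF order_refl, THEN spec, THEN mp, OF less_imp_le[OF elim(3)],
          THEN conjunct2])
  ultimately show ?case by (simp only:)
qed

definition large_root :: "real \<Rightarrow> nat \<Rightarrow> 'a set" where
  "large_root x d = {\<omega>\<in>space M. x < real (root_in_degree birth parent chi \<omega>) \<and> D 1 \<omega> = d}"

lemma in_large_root:
  "\<omega> \<in> large_root x d \<longleftrightarrow>
    \<omega> \<in> space M \<and> x < real (root_in_degree birth parent chi \<omega>) \<and> D 1 \<omega> = d"
  by (simp add: large_root_def)

lemma large_root_measurable: "large_root x d \<in> sets M"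
proof -
  have [measurable]: "D 1 \<in> measurable M (count_space UNIV)" by (rule D_measurable) simp
  show ?thesis unfolding large_root_def by measurable
qed

text \<open>The pigeonhole principle: if \<open>d\<close> counts add up to more than \<open>x\<close>, one of them is at least \<open>x / d\<close>,
  also after \<open>chi\<close> is replaced by a later point of the grid.\<close>

lemma large_root_grid_bound:
  assumes "0 \<le> x"
  shows "prob (large_root x d)
    \<le> (\<Sum>i=1..d. prob {\<omega>\<in>space M. D 1 \<omega> = d \<and> nat \<lceil>x / real d\<rceil> \<le> \<xi> 1 i (grid_clock 1 N (chi \<omega>)) \<omega>})"
proof -
  let ?A = "\<lambda>i. {\<omega>\<in>space M. D 1 \<omega> = d \<and> nat \<lceil>x / real d\<rceil> \<le> \<xi> 1 i (grid_clock 1 N (chi \<omega>)) \<omega>}"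
  have sets: "?A ` {1..d} \<subseteq> sets M"
    by (intro image_subsetI grid_clock_event) simp
  have "AE \<omega> in M. \<omega> \<in> large_root x d \<longrightarrow> \<omega> \<in> (\<Union>i\<in>{1..d}. ?A i)"
    using root_in_degree_eq_offspring chi_pos births_mono
  proof eventually_elim
    case (elim \<omega>)
    show ?case
    proof
      assume large: "\<omega> \<in> large_root x d"
      then have x: "x < (\<Sum>i=1..d. real (\<xi> 1 i (chi \<omega>) \<omega>))"
        using elim(1) by (auto simp: in_large_root offspring_def)
      have "\<exists>i\<in>{1..d}. x / real d \<le> real (\<xi> 1 i (chi \<omega>) \<omega>)"
      proof (rule ccontr)
        assume "\<not> ?thesis"
        then have "real (\<xi> 1 i (chi \<omega>) \<omega>) \<le> x / real d" if "i \<in> {1..d}" for i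
          using that by (meson linear)
        then have "(\<Sum>i=1..d. real (\<xi> 1 i (chi \<omega>) \<omega>)) \<le> (\<Sum>i=1..d. x / real d)"
          by (rule sum_mono)
        also have "\<dots> \<le> x"
          using \<open>0 \<le> x\<close> by (cases "d = 0") auto
        finally show False using x by simp
      qed
      then obtain i where i: "i \<in> {1..d}" "x / real d \<le> real (\<xi> 1 i (chi \<omega>) \<omega>)" by blast
      have "\<xi> 1 i (chi \<omega>) \<omega> \<le> \<xi> 1 i (grid_clock 1 N (chi \<omega>)) \<omega>"
      proof (rule mono_onD[where A = "{0..}" and f = "\<lambda>t. \<xi> 1 i t \<omega>"])
        show "mono_on {0..} (\<lambda>t. \<xi> 1 i t \<omega>)" using elim(3) i(1) by simp
      qed (use elim(2) le_grid_clock_1[of "chi \<omega>" N] in simp_all)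
      moreover have "nat \<lceil>x / real d\<rceil> \<le> \<xi> 1 i (chi \<omega>) \<omega>"
        using i(2) by (simp add: nat_le_iff ceiling_le_iff)
      ultimately show "\<omega> \<in> (\<Union>i\<in>{1..d}. ?A i)"
        using large i(1) by (intro UN_I[of i]) (auto simp: in_large_root)
    qed
  qed
  then have "prob (large_root x d) \<le> prob (\<Union>i\<in>{1..d}. ?A i)"
    by (rule finite_measure_mono_AE) (use sets in \<open>intro sets.finite_UN; auto\<close>)
  also have "\<dots> \<le> (\<Sum>i=1..d. prob (?A i))"
    by (rule finite_measure_subadditive_finite[OF _ sets]) simp
  finally show ?thesis .
qed

lemma prob_large_root_le:
  assumes "0 \<le> x"
  shows "prob (large_root x d)
    \<le> pmf H d * (real d * (\<Prod>j=1..nat \<lceil>x / real d\<rceil>. f j / (lam + f j)))"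
proof -
  have "(\<lambda>N. \<Sum>i=1..d. prob {\<omega>\<in>space M. D 1 \<omega> = d \<and>
          nat \<lceil>x / real d\<rceil> \<le> \<xi> 1 i (grid_clock 1 N (chi \<omega>)) \<omega>})
      \<longlonglongrightarrow> (\<Sum>i=1..d. pmf H d * (\<Prod>j=1..nat \<lceil>x / real d\<rceil>. f j / (lam + f j)))"
    by (intro tendsto_sum prob_mark_birth_at_grid_clock_tendsto) auto
  then have "prob (large_root x d)
      \<le> (\<Sum>i=1..d. pmf H d * (\<Prod>j=1..nat \<lceil>x / real d\<rceil>. f j / (lam + f j)))"
    by (rule LIMSEQ_le_const) (intro exI allI impI large_root_grid_bound[OF assms])
  then show ?thesis by (simp add: mult.left_commute)
qed

text \<open>The strict inequality \<open>root_in_degree > x\<close> requires the level \<open>\<lceil>x\<rceil> + 1\<close> when \<open>x\<close> is an integer.\<close>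

lemma prob_large_root_1_ge:
  "pmf H 1 * (\<Prod>j=1..Suc (nat \<lceil>x\<rceil>). f j / (lam + f j)) \<le> prob (large_root x 1)"
proof (rule LIMSEQ_le_const2)
  let ?A = "\<lambda>N. {\<omega>\<in>space M. D 1 \<omega> = 1 \<and> Suc (nat \<lceil>x\<rceil>) \<le> \<xi> 1 1 (grid_clock 0 N (chi \<omega>)) \<omega>}"
  show "(\<lambda>N. prob (?A N)) \<longlonglongrightarrow> pmf H 1 * (\<Prod>j=1..Suc (nat \<lceil>x\<rceil>). f j / (lam + f j))"
    by (rule prob_mark_birth_at_grid_clock_tendsto) simp
  have "prob (?A N) \<le> prob (large_root x 1)" for N
  proof (rule finite_measure_mono_AE[OF _ large_root_measurable])
    show "AE \<omega> in M. \<omega> \<in> ?A N \<longrightarrow> \<omega> \<in> large_root x 1"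
      using root_in_degree_eq_offspring chi_pos births_mono
    proof eventually_elim
      case (elim \<omega>)
      have "\<xi> 1 1 (grid_clock 0 N (chi \<omega>)) \<omega> \<le> \<xi> 1 1 (chi \<omega>) \<omega>"
      proof (rule mono_onD[where A = "{0..}" and f = "\<lambda>t. \<xi> 1 1 t \<omega>"])
        show "mono_on {0..} (\<lambda>t. \<xi> 1 1 t \<omega>)" using elim(3) by simp
      qed (use elim(2) grid_clock_0_le[of "chi \<omega>" N] in simp_all)
      moreover have "x < real (Suc (nat \<lceil>x\<rceil>))" by linarith
      ultimately show ?case
        using elim(1) by (auto simp: in_large_root offspring_def)
    qed
  qed
  then show "\<exists>k. \<forall>N\<ge>k. prob (?A N) \<le> prob (large_root x 1)" by blast
qed

text \<open>If \<open>chi > t\<close> and all \<open>d\<close> processes have reached the level by time \<open>t\<close>, then so they have by time \<open>chi\<close>,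
  and \<open>d * (\<lceil>x / d\<rceil> + 1) > x\<close>. By a union bound, one of them is late with probability at most
  \<open>1 / 2\<close>, also given \<open>chi\<close> and \<open>D 1\<close>.\<close>

lemma prob_large_root_ge:
  assumes "1 \<le> d" "0 \<le> t" "0 < x"
    and half: "1 - q \<le> 1 / (2 * real d)"
    and q: "\<And>i. 1 \<le> i \<Longrightarrow> q \<le> upper_tail M (\<xi> 1 i) (Suc (nat \<lceil>x / real d\<rceil>)) t"
  shows "pmf H d * (1 / 2 * exp (- lam * t)) \<le> prob (large_root x d)"
proof -
  let ?m = "Suc (nat \<lceil>x / real d\<rceil>)"
  let ?A = "{\<omega>\<in>space M. t < chi \<omega> \<and> D 1 \<omega> = d}"
  let ?B = "\<lambda>i. {\<omega>\<in>space M. t < chi \<omega> \<and> D 1 \<omega> = d \<and> \<xi> 1 i t \<omega> \<in> {..<?m}}"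
  have [measurable]: "D 1 \<in> measurable M (count_space UNIV)" by (rule D_measurable) simp
  have A: "?A \<in> sets M" by measurable
  have B: "?B i \<in> sets M" if "1 \<le> i" for i
  proof -
    have "?B i = ?A \<inter> (\<xi> 1 i t -` {..<?m} \<inter> space M)" by auto
    also have "\<dots> \<in> sets M"
      by (rule sets.Int[OF A measurable_sets[OF \<xi>_measurable[OF that \<open>0 \<le> t\<close>]]]) simp
    finally show ?thesis .
  qed
  have UB: "(\<Union>i\<in>{1..d}. ?B i) \<in> sets M"
    by (rule sets.finite_UN, simp, rule B, simp)
  have "prob {\<omega>\<in>space M. \<xi> 1 i t \<omega> \<in> {..<?m}} \<le> 1 / (2 * real d)" if "1 \<le> i" for i
  proof -
    have "\<xi> 1 i t -` {..<?m} \<inter> space M \<in> events"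
      by (rule measurable_sets[OF \<xi>_measurable[OF that \<open>0 \<le> t\<close>]]) simp
    moreover have "\<xi> 1 i t -` {..<?m} \<inter> space M = {\<omega>\<in>space M. \<xi> 1 i t \<omega> \<in> {..<?m}}" by auto
    moreover have "{\<omega>\<in>space M. ?m \<le> \<xi> 1 i t \<omega>} = space M - {\<omega>\<in>space M. \<xi> 1 i t \<omega> \<in> {..<?m}}"
      by auto
    ultimately have "upper_tail M (\<xi> 1 i) ?m t = 1 - prob {\<omega>\<in>space M. \<xi> 1 i t \<omega> \<in> {..<?m}}"
      unfolding upper_tail_def by (simp only: prob_compl)
    with q[OF that] half show ?thesis by linarith
  qed
  then have Bi: "prob (?B i) \<le> exp (- lam * t) * pmf H d * (1 / (2 * real d))" if "1 \<le> i" for i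
    unfolding prob_chi_mark_birth[OF that \<open>0 \<le> t\<close>] using that by (intro mult_left_mono) auto
  have "exp (- lam * t) * pmf H d = prob ?A"
    using prob_chi_mark_birth[of 1 t d UNIV] \<open>0 \<le> t\<close> by (simp add: prob_space)
  also have "\<dots> \<le> prob (large_root x d \<union> (\<Union>i\<in>{1..d}. ?B i))"
  proof (rule finite_measure_mono_AE)
    show "AE \<omega> in M. \<omega> \<in> ?A \<longrightarrow> \<omega> \<in> large_root x d \<union> (\<Union>i\<in>{1..d}. ?B i)"
      using root_in_degree_eq_offspring births_mono
    proof eventually_elim
      case (elim \<omega>)
      show ?case
      proof (rule impI, rule UnCI)
        assume A: "\<omega> \<in> ?A" and notB: "\<omega> \<notin> (\<Union>i\<in>{1..d}. ?B i)"
        have "real ?m \<le> real (\<xi> 1 i (chi \<omega>) \<omega>)" if "i \<in> {1..d}" for i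
        proof -
          have "?m \<le> \<xi> 1 i t \<omega>" using A notB that by (auto simp: not_less)
          also have "\<dots> \<le> \<xi> 1 i (chi \<omega>) \<omega>"
          proof (rule mono_onD[where A = "{0..}" and f = "\<lambda>t. \<xi> 1 i t \<omega>"])
            show "mono_on {0..} (\<lambda>t. \<xi> 1 i t \<omega>)" using elim(2) that by simp
          qed (use A \<open>0 \<le> t\<close> in simp_all)
          finally show ?thesis by simp
        qed
        then have "(\<Sum>i=1..d. real ?m) \<le> (\<Sum>i=1..d. real (\<xi> 1 i (chi \<omega>) \<omega>))"
          by (intro sum_mono)
        moreover have "x < real d * real ?m"
        proof -
          have "x / real d < real ?m" by linarith
          then show ?thesis using \<open>1 \<le> d\<close> by (simp add: field_simps)
        qed
        ultimately show "\<omega> \<in> large_root x d"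
          using A elim(1) by (auto simp: in_large_root offspring_def)
      qed
    qed
    show "large_root x d \<union> (\<Union>i\<in>{1..d}. ?B i) \<in> sets M"
      by (rule sets.Un[OF large_root_measurable UB])
  qed
  also have "\<dots> \<le> prob (large_root x d) + prob (\<Union>i\<in>{1..d}. ?B i)"
    by (rule measure_Un_le[OF large_root_measurable UB])
  finally have "exp (- lam * t) * pmf H d \<le> prob (large_root x d) + prob (\<Union>i\<in>{1..d}. ?B i)" .
  moreover have "prob (\<Union>i\<in>{1..d}. ?B i) \<le> 1 / 2 * (exp (- lam * t) * pmf H d)"
  proof -
    have "prob (\<Union>i\<in>{1..d}. ?B i) \<le> (\<Sum>i=1..d. prob (?B i))"
      by (rule finite_measure_subadditive_finite) (simp, intro image_subsetI B, simp)
    also have "\<dots> \<le> (\<Sum>i=1..d. exp (- lam * t) * pmf H d * (1 / (2 * real d)))"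
      using Bi by (intro sum_mono) auto
    also have "\<dots> = 1 / 2 * (exp (- lam * t) * pmf H d)"
      using \<open>1 \<le> d\<close> by simp
    finally show ?thesis .
  qed
  ultimately show ?thesis by (simp add: mult.commute)
qed

text \<open>Chernoff's bound with exponent \<open>s = c / 2\<close> at the time at which it equals \<open>1 / (2 d)\<close>.\<close>

lemma tail_at_threshold_time:
  assumes c: "0 < c" "\<And>k. 1 \<le> k \<Longrightarrow> c \<le> f k" and "1 \<le> d" and "1 \<le> i"
  shows "1 - 1 / (2 * real d) \<le> upper_tail M (\<xi> 1 i) m
    (G_sum f 1 m + c / 2 * G_sum f 2 m + ln (2 * real d) / (c / 2))"
proof -
  define s t where "s = c / 2" and "t = G_sum f 1 m + s * G_sum f 2 m + ln (2 * real d) / s"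
  have s: "0 < s" "s < f k" "2 * s \<le> f k" if "1 \<le> k" for k
    using c(1) c(2)[OF that] by (auto simp: s_def)
  have "0 < s" using c by (simp add: s_def)
  have "0 \<le> t"
    unfolding t_def using \<open>0 < s\<close> \<open>1 \<le> d\<close>
    by (intro add_nonneg_nonneg mult_nonneg_nonneg G_sum_nonneg f_pos divide_nonneg_nonneg ln_ge_zero) auto
  have "1 - upper_tail M (\<xi> 1 i) m t \<le> exp (- s * t) * (\<Prod>j=1..m. f j / (f j - s))"
    by (rule upper_tail_Chernoff[of f]) (use s \<open>0 < s\<close> \<open>0 \<le> t\<close> assms births_copy in auto)
  also have "\<dots> \<le> exp (- s * t) * exp (s * G_sum f 1 m + s\<^sup>2 * G_sum f 2 m)"
    by (intro mult_left_mono Chernoff_prod_le_exp s \<open>0 < s\<close>) auto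
  also have "\<dots> = exp (- ln (2 * real d))"
    using \<open>0 < s\<close> by (simp add: t_def algebra_simps power2_eq_square flip: exp_add)
  also have "\<dots> = 1 / (2 * real d)"
    using \<open>1 \<le> d\<close> by (simp add: exp_minus inverse_eq_divide)
  finally show ?thesis by (simp add: t_def s_def)
qed

text \<open>For \<open>d \<ge> 2\<close> the quantity \<open>L = log (2 d)\<close> is at least 1, as \<open>threshold_time_le\<close> requires; for \<open>d = 1\<close> it
  is not. In that case the exact product for the level \<open>n + 1\<close> is used, where the additional summand
  \<open>1 / f (n + 1)\<close> is absorbed by the second-order term.\<close>

lemma prob_large_root_lower_bound:
  assumes c: "0 < c" "\<And>k. 1 \<le> k \<Longrightarrow> c \<le> f k" and "1 \<le> d" and "0 < x"
  defines "n \<equiv> nat \<lceil>x / real d\<rceil>"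
  shows "pmf H d * (1 / 2 * exp (- lam * (G_sum f 1 n + 4 * (f 1)\<^sup>2 / c * ln (2 * real d) * G_sum f 2 n)))
    \<le> prob (large_root x d)"
proof -
  have n: "1 \<le> n"
  proof -
    have "0 < x / real d" using assms by simp
    then have "1 \<le> \<lceil>x / real d\<rceil>" by linarith
    then show ?thesis by (simp add: n_def le_nat_iff)
  qed
  show ?thesis
  proof (cases "d = 1")
    case True
    have nx: "n = nat \<lceil>x\<rceil>" by (simp add: n_def True)
    define a where "a = (f 1)\<^sup>2 / c * G_sum f 2 n"
    have a: "1 / c \<le> a"
      unfolding a_def by (rule inverse_lower_bound_le_G_sum_2[OF c n])
    then have a0: "0 < a" using c(1) by (meson divide_pos_pos less_le_trans zero_less_one)
    have "1 / f (Suc n) \<le> 1 / c" using c by (intro frac_le) auto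
    also have "\<dots> \<le> (4 * ln 2) * a"
    proof -
      have "1 * a \<le> (4 * ln 2) * a"
        using ln2_ge_two_thirds a0 by (intro mult_right_mono) auto
      with a show ?thesis by simp
    qed
    also have "\<dots> = 4 * (f 1)\<^sup>2 / c * ln (2 * real d) * G_sum f 2 n"
      by (simp add: a_def True)
    finally have "lam * G_sum f 1 (Suc n)
        \<le> lam * (G_sum f 1 n + 4 * (f 1)\<^sup>2 / c * ln (2 * real d) * G_sum f 2 n)"
      using lam_pos by (intro mult_left_mono) (simp_all add: G_sum_Suc)
    then have "exp (- lam * (G_sum f 1 n + 4 * (f 1)\<^sup>2 / c * ln (2 * real d) * G_sum f 2 n))
        \<le> exp (- lam * G_sum f 1 (Suc n))" by simp
    also have "\<dots> \<le> (\<Prod>j=1..Suc n. f j / (lam + f j))"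
      by (rule exp_le_rate_prod[OF f_pos lam_pos])
    finally have "1 / 2 * exp (- lam * (G_sum f 1 n + 4 * (f 1)\<^sup>2 / c * ln (2 * real d) * G_sum f 2 n))
        \<le> (\<Prod>j=1..Suc n. f j / (lam + f j))"
      using exp_gt_zero[of "- lam * (G_sum f 1 n + 4 * (f 1)\<^sup>2 / c * ln (2 * real d) * G_sum f 2 n)"]
      by linarith
    then have "pmf H d * (1 / 2 * exp (- lam * (G_sum f 1 n + 4 * (f 1)\<^sup>2 / c * ln (2 * real d) * G_sum f 2 n)))
        \<le> pmf H d * (\<Prod>j=1..Suc n. f j / (lam + f j))"
      by (rule mult_left_mono) simp
    also have "\<dots> \<le> prob (large_root x d)"
      unfolding True nx by (rule prob_large_root_1_ge)
    finally show ?thesis .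
  next
    case False
    then have d: "2 \<le> d" using \<open>1 \<le> d\<close> by simp
    define L where "L = ln (2 * real d)"
    have L: "1 \<le> L"
    proof -
      have "exp 1 \<le> 2 * real d" using exp_le d by linarith
      then show ?thesis using d by (simp add: L_def ln_ge_iff)
    qed
    define t where "t = G_sum f 1 (Suc n) + c / 2 * G_sum f 2 (Suc n) + L / (c / 2)"
    have "0 \<le> t"
      unfolding t_def using c(1) L
      by (intro add_nonneg_nonneg mult_nonneg_nonneg G_sum_nonneg f_pos divide_nonneg_nonneg) auto
    have "t \<le> G_sum f 1 n + 4 * (f 1)\<^sup>2 / c * L * G_sum f 2 n"
      unfolding t_def by (rule threshold_time_le[OF c n L])
    then have "exp (- lam * (G_sum f 1 n + 4 * (f 1)\<^sup>2 / c * L * G_sum f 2 n)) \<le> exp (- lam * t)"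
      using lam_pos by simp
    then have "pmf H d * (1 / 2 * exp (- lam * (G_sum f 1 n + 4 * (f 1)\<^sup>2 / c * L * G_sum f 2 n)))
        \<le> pmf H d * (1 / 2 * exp (- lam * t))"
      by (intro mult_left_mono) auto
    also have "\<dots> \<le> prob (large_root x d)"
    proof (rule prob_large_root_ge[OF \<open>1 \<le> d\<close> \<open>0 \<le> t\<close> \<open>0 < x\<close>])
      show "1 - (1 - 1 / (2 * real d)) \<le> 1 / (2 * real d)" by simp
      show "1 - 1 / (2 * real d) \<le> upper_tail M (\<xi> 1 i) (Suc (nat \<lceil>x / real d\<rceil>)) t" if "1 \<le> i" for i
        unfolding t_def L_def n_def by (rule tail_at_threshold_time[OF c \<open>1 \<le> d\<close> that])
    qed
    finally show ?thesis by (simp add: L_def)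
  qed
qed

lemma prob_large_root_upper_bound:
  fixes d :: nat and x :: real
  assumes "0 \<le> x"
  defines "n \<equiv> nat \<lceil>x / real d\<rceil>"
  shows "prob (large_root x d)
    \<le> pmf H d * ((2 * real d + 1) * exp (- lam * G_sum f 1 n + 2 * lam\<^sup>2 * G_sum f 2 n))"
proof -
  have "0 \<le> lam\<^sup>2 * G_sum f 2 n" by (intro mult_nonneg_nonneg G_sum_nonneg f_pos) auto
  then have "exp (- lam * G_sum f 1 n + lam\<^sup>2 * G_sum f 2 n)
      \<le> exp (- lam * G_sum f 1 n + 2 * lam\<^sup>2 * G_sum f 2 n)" by simp
  with rate_prod_le_exp[of f, OF f_pos lam_pos, where n = n]
  have "(\<Prod>j=1..n. f j / (lam + f j)) \<le> exp (- lam * G_sum f 1 n + 2 * lam\<^sup>2 * G_sum f 2 n)"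
    by linarith
  then have "real d * (\<Prod>j=1..n. f j / (lam + f j))
      \<le> (2 * real d + 1) * exp (- lam * G_sum f 1 n + 2 * lam\<^sup>2 * G_sum f 2 n)"
    by (intro mult_mono prod_nonneg) (auto intro!: divide_nonneg_nonneg simp: f_pos less_imp_le lam_pos add_nonneg_nonneg)
  then have "pmf H d * (real d * (\<Prod>j=1..n. f j / (lam + f j)))
      \<le> pmf H d * ((2 * real d + 1) * exp (- lam * G_sum f 1 n + 2 * lam\<^sup>2 * G_sum f 2 n))"
    by (rule mult_left_mono) simp
  with prob_large_root_le[OF \<open>0 \<le> x\<close>, of d] show ?thesis unfolding n_def by linarith
qed

lemma prob_large_root_sums:
  "(\<lambda>d. prob (large_root x d)) sums prob {\<omega>\<in>space M. x < real (root_in_degree birth parent chi \<omega>)}"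
proof -
  have "(\<lambda>d. prob (large_root x d)) sums prob (\<Union>d. large_root x d)"
    by (rule finite_measure_UNION) (use large_root_measurable in \<open>auto simp: disjoint_family_on_def in_large_root\<close>)
  also have "(\<Union>d. large_root x d) = {\<omega>\<in>space M. x < real (root_in_degree birth parent chi \<omega>)}"
    by (auto simp: in_large_root)
  finally show ?thesis .
qed

end

section \<open>Averaging over the mark of the root\<close>

lemma pmf_expectation_sums:
  fixes g :: "nat \<Rightarrow> real"
  assumes "integrable (measure_pmf H) g"
  shows "(\<lambda>d. pmf H d * g d) sums measure_pmf.expectation H g"
proof -
  have "integrable (count_space UNIV) (\<lambda>d. pmf H d * g d)"
    using assms unfolding measure_pmf_eq_density by (subst (asm) integrable_density) auto
  moreover have "measure_pmf.expectation H g = (\<integral>d. pmf H d * g d \<partial>count_space UNIV)"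
    unfolding measure_pmf_eq_density by (subst integral_density) auto
  ultimately show ?thesis
    by (simp add: sums_integral_count_space_nat)
qed

theorem proposition2:
  fixes f :: "nat \<Rightarrow> real" and H :: "nat pmf" and lam x :: real
    and N :: "'b measure" and \<xi>\<^sub>f :: "real \<Rightarrow> 'b \<Rightarrow> nat"
    and M :: "'a measure" and D :: "nat \<Rightarrow> 'a \<Rightarrow> nat"
    and \<xi> :: "nat \<Rightarrow> nat \<Rightarrow> real \<Rightarrow> 'a \<Rightarrow> nat"
    and birth :: "nat \<Rightarrow> 'a \<Rightarrow> real" and parent :: "nat \<Rightarrow> 'a \<Rightarrow> nat"
    and chi :: "'a \<Rightarrow> real"
  assumes "pure_birth_process N f \<xi>\<^sub>f"
    and "main_assumption f H (rho_hat N \<xi>\<^sub>f)"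
    and "malthusian_rate (rho_hat N \<xi>\<^sub>f) lam"
    and "marked_branching_process M f H D \<xi> birth parent"
    and "distributed M lborel chi (exponential_density lam)"
    and "indep_rv M borel chi (mark_space \<Otimes>\<^sub>M birth_space)
           (\<lambda>\<omega>. (mark_family D \<omega>, birth_family \<xi> \<omega>))"
    and "x > 0"
  shows "\<P>(\<omega> in M. real (root_in_degree birth parent chi \<omega>) > x)
      \<le> measure_pmf.expectation H
           (\<lambda>d. (2 * real d + 1) *
                exp (- lam * G_sum f 1 (nat \<lceil>x / real d\<rceil>)
                     + 2 * lam\<^sup>2 * G_sum f 2 (nat \<lceil>x / real d\<rceil>)))
    \<and> \<P>(\<omega> in M. real (root_in_degree birth parent chi \<omega>) > x)
      \<ge> 1 / 2 * measure_pmf.expectation H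
           (\<lambda>d. exp (- lam * (G_sum f 1 (nat \<lceil>x / real d\<rceil>)
                     + 4 * (f 1)\<^sup>2 / f_star f * ln (2 * real d)
                       * G_sum f 2 (nat \<lceil>x / real d\<rceil>))))"
proof -
  define c where "c = f_star f"
  have f_nonneg: "0 \<le> f k" if "1 \<le> k" for k
    using assms(2) that by (auto simp: main_assumption_def)
  have c_pos: "0 < c"
    using assms(2) by (auto simp: main_assumption_def c_def)
  have c_le: "c \<le> f k" if "1 \<le> k" for k
    unfolding c_def f_star_def
    by (rule cINF_lower) (use f_nonneg that in \<open>auto intro!: bdd_belowI[of _ 0]\<close>)
  have f_pos: "0 < f k" if "1 \<le> k" for k
    using c_pos c_le[OF that] by linarith
  have lam_pos: "0 < lam"
    using assms(3) by (simp add: malthusian_rate_def)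
  interpret stopped_branching_process M f H D \<xi> birth parent chi lam
    by (intro stopped_branching_process.intro stopped_branching_process_axioms.intro assms
        lam_pos f_pos)
  define n where "n d = nat \<lceil>x / real d\<rceil>" for d :: nat
  define u where "u d = (2 * real d + 1) * exp (- lam * G_sum f 1 (n d) + 2 * lam\<^sup>2 * G_sum f 2 (n d))"
    for d :: nat
  define l where "l d = exp (- lam * (G_sum f 1 (n d)
      + 4 * (f 1)\<^sup>2 / f_star f * ln (2 * real d) * G_sum f 2 (n d)))" for d :: nat
  let ?P = "\<P>(\<omega> in M. real (root_in_degree birth parent chi \<omega>) > x)"
  have H0: "pmf H 0 = 0"
    using assms(2) by (auto simp: main_assumption_def pmf_eq_0_set_pmf)
  \<comment> \<open>The levels \<open>n d\<close> are bounded by \<open>\<lceil>x\<rceil>\<close>, so the exponential factor of \<open>u\<close> is bounded, and \<open>u\<close> is integrable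
    because \<open>H\<close> has a finite mean.\<close>
  have int_u: "integrable (measure_pmf H) u"
  proof (rule Bochner_Integration.integrable_bound)
    have int_H: "integrable (measure_pmf H) real"
      using assms(2) by (simp add: main_assumption_def)
    show "integrable (measure_pmf H) (\<lambda>d. (2 * real d + 1) * exp (2 * lam\<^sup>2 * G_sum f 2 (nat \<lceil>x\<rceil>)))"
      by (intro integrable_mult_left Bochner_Integration.integrable_add integrable_mult_right int_H) simp
    have "u d \<le> (2 * real d + 1) * exp (2 * lam\<^sup>2 * G_sum f 2 (nat \<lceil>x\<rceil>))" for d
    proof -
      have "x / real d \<le> x"
        using \<open>x > 0\<close> by (cases "d = 0") (simp_all add: pos_divide_le_eq)
      then have "n d \<le> nat \<lceil>x\<rceil>"
        unfolding n_def by (intro nat_mono ceiling_mono)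
      then have "2 * lam\<^sup>2 * G_sum f 2 (n d) \<le> 2 * lam\<^sup>2 * G_sum f 2 (nat \<lceil>x\<rceil>)"
        by (intro mult_left_mono G_sum_mono f_pos) auto
      moreover have "0 \<le> lam * G_sum f 1 (n d)"
        using lam_pos by (intro mult_nonneg_nonneg G_sum_nonneg f_pos) auto
      ultimately show ?thesis
        unfolding u_def by (intro mult_left_mono) auto
    qed
    then show "AE d in measure_pmf H. norm (u d)
        \<le> norm ((2 * real d + 1) * exp (2 * lam\<^sup>2 * G_sum f 2 (nat \<lceil>x\<rceil>)))"
      by (intro AE_I2) (simp add: u_def)
  qed simp
  have int_l: "integrable (measure_pmf H) (\<lambda>d. 1 / 2 * l d)"
  proof (rule measure_pmf.integrable_const_bound[where B = 1])
    have "1 / 2 * l d \<le> 1" if "d \<in> set_pmf H" for d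
    proof -
      have "1 \<le> d"
        using assms(2) that by (cases d) (auto simp: main_assumption_def)
      then have "0 \<le> 4 * (f 1)\<^sup>2 / f_star f * ln (2 * real d) * G_sum f 2 (n d)"
        using c_pos unfolding c_def
        by (intro mult_nonneg_nonneg divide_nonneg_pos G_sum_nonneg f_pos ln_ge_zero) auto
      with G_sum_nonneg[OF f_pos]
      have "0 \<le> G_sum f 1 (n d) + 4 * (f 1)\<^sup>2 / f_star f * ln (2 * real d) * G_sum f 2 (n d)"
        by (rule add_nonneg_nonneg)
      then have "0 \<le> lam * (G_sum f 1 (n d)
          + 4 * (f 1)\<^sup>2 / f_star f * ln (2 * real d) * G_sum f 2 (n d))"
        using lam_pos by (intro mult_nonneg_nonneg) auto
      then have "l d \<le> 1"
        unfolding l_def by simp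
      then show ?thesis by linarith
    qed
    then show "AE d in measure_pmf H. norm (1 / 2 * l d) \<le> 1"
      by (auto simp: AE_measure_pmf_iff l_def)
  qed simp
  have "?P \<le> measure_pmf.expectation H u"
  proof (rule sums_le[OF _ prob_large_root_sums pmf_expectation_sums[OF int_u]])
    show "prob (large_root x d) \<le> pmf H d * u d" for d
      unfolding u_def n_def by (rule prob_large_root_upper_bound) (use \<open>x > 0\<close> in simp)
  qed
  moreover have "measure_pmf.expectation H (\<lambda>d. 1 / 2 * l d) \<le> ?P"
  proof (rule sums_le[OF _ pmf_expectation_sums[OF int_l] prob_large_root_sums])
    show "pmf H d * (1 / 2 * l d) \<le> prob (large_root x d)" for d
    proof (cases "d = 0")
      case False
      then show ?thesis
        unfolding l_def n_def c_def[symmetric]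
        by (intro prob_large_root_lower_bound c_pos c_le \<open>x > 0\<close>) auto
    qed (simp add: H0)
  qed
  then have "1 / 2 * measure_pmf.expectation H l \<le> ?P"
    by simp
  ultimately show ?thesis
    unfolding u_def l_def n_def by blast
qed

end
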